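(* Let $Q(x,y,z)$ be an irreducible (over $\mathbb C$) quadratic form with real coefficients and signature distinct from $-3$. Then any real polynomial $P(x,y,z)$ of degree $d$, restricted to the real quadric surface $\mathcal S^{\mathbb R}=\{Q(x,y,z)=1\}$ in $\mathbb R^3_\ast$, has a representation $$P(x,y,z)=\lambda_0+\sum_{k=1}^d\lambda_k\Big[\prod_{j=1}^k(a_{k,j}x+b_{k,j}y+c_{k,j}z)\Big],$$ where each $(a_{k,j},b_{k,j},c_{k,j})\in\mathbb R^3$ is a unit vector, $\lambda_k\in\mathbb R$ and, for $k>0$, $\lambda_k\ge0$. When the surface $\mathcal S^{\mathbb R}$ is an ellipsoid, this representation is unique, up to reordering and rescaling of the multipliers in the products. In such a case, $P$ gives rise to a unique sequence of multipoles $\{w_k\in\overline{\mathcal M}^{\mathbb R}(k)\}_k$.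
   Context: $\mathbb R^3_\ast$ is real 3-space with coordinates $x,y,z$. An irreducible quadratic form in three variables over $\mathbb C$ is the same as a non-degenerate one; signature $-3$ means negative definite. The real multipole space is $\mathcal M^{\mathbb R}(k)=[\mathbb R^3\setminus\{0\}]^k/\Sigma_k^{\mathbb R}$, where $\mathbb R^3$ is the space of coefficient vectors of real linear forms and $\Sigma_k^{\mathbb R}$ is generated by the permutations $S_k$ of factors and by $H_k^{\mathbb R}=\{(\lambda_\nu)\in(\mathbb R^\ast)^k:\prod\lambda_\nu=1\}$ acting by rescaling; its points correspond bijectively to products of $k$ non-zero real linear forms. $\overline{\mathcal M}^{\mathbb R}(k)=\mathcal M^{\mathbb R}(k)\cup\{\mathbf 0\}$, with the zero multipole $\mathbf 0$ representing the zero product. The multipole $w_k$ associated with the representation corresponds to the product $\lambda_k\prod_{j=1}^k(a_{k,j}x+b_{k,j}y+c_{k,j}z)$. *)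

theory Defs
  imports "HOL-Analysis.Analysis" "HOL-Library.Poly_Mapping"
    "HOL-Computational_Algebra.Factorial_Ring"
begin

text \<open>
  A polynomial in three variables is a finitely supported map from exponents to coefficients;
  the ring structure is the convolution product supplied by \<open>Poly_Mapping\<close>.
\<close>

type_synonym 'a poly3 = "(3 \<Rightarrow>\<^sub>0 nat) \<Rightarrow>\<^sub>0 'a"

definition monomial_degree :: "(3 \<Rightarrow>\<^sub>0 nat) \<Rightarrow> nat" where
  "monomial_degree m = (\<Sum>i\<in>UNIV. Poly_Mapping.lookup m i)"

text \<open>The zero polynomial gets total degree \<open>0\<close>.\<close>

definition total_degree :: "'a::zero poly3 \<Rightarrow> nat" where
  "total_degree p = Max (insert 0 (monomial_degree ` Poly_Mapping.keys p))"

definition eval3 :: "'a::comm_semiring_1 poly3 \<Rightarrow> 'a ^ 3 \<Rightarrow> 'a" where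
  "eval3 p v = (\<Sum>m\<in>Poly_Mapping.keys p.
     Poly_Mapping.lookup p m * (\<Prod>i\<in>UNIV. (v $ i) ^ Poly_Mapping.lookup m i))"

definition quadratic_form :: "'a::zero poly3 \<Rightarrow> bool" where
  "quadratic_form q \<longleftrightarrow> (\<forall>m\<in>Poly_Mapping.keys q. monomial_degree m = 2)"

definition complexify :: "real poly3 \<Rightarrow> complex poly3" where
  "complexify p = Poly_Mapping.map complex_of_real p"

text \<open>
  The signature is the positive minus the negative index of inertia, the indices being the
  largest dimensions of subspaces on which the form is positive, respectively negative, definite.
\<close>

definition positive_index :: "(real ^ 3 \<Rightarrow> real) \<Rightarrow> nat" where
  "positive_index q = Max {dim V |V. subspace V \<and> (\<forall>v\<in>V. v \<noteq> 0 \<longrightarrow> q v > 0)}"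

definition signature :: "real poly3 \<Rightarrow> int" where
  "signature q = int (positive_index (eval3 q)) - int (positive_index (\<lambda>v. - eval3 q v))"

definition quadric_surface :: "real poly3 \<Rightarrow> (real ^ 3) set" where
  "quadric_surface q = {v. eval3 q v = 1}"

definition ellipsoid :: "(real ^ 3) set \<Rightarrow> bool" where
  "ellipsoid E \<longleftrightarrow> (\<exists>c (f :: real ^ 3 \<Rightarrow> real ^ 3). linear f \<and> bij f \<and> E = (\<lambda>v. c + f v) ` sphere 0 1)"

text \<open>
  A linear form \<open>a x + b y + c z\<close> is given by its coefficient vector, so that its value at \<open>v\<close> is
  an inner product. The factors of the degree \<open>k\<close> term are \<open>u k 1, \<dots>, u k k\<close>; the values
  of \<open>c\<close> and \<open>u\<close> outside the stated index ranges are irrelevant.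
\<close>

definition multipole_representation ::
  "real poly3 \<Rightarrow> real poly3 \<Rightarrow> nat \<Rightarrow> (nat \<Rightarrow> real) \<Rightarrow> (nat \<Rightarrow> nat \<Rightarrow> real ^ 3) \<Rightarrow> bool" where
  "multipole_representation q p d c u \<longleftrightarrow>
     (\<forall>k\<in>{1..d}. c k \<ge> 0 \<and> (\<forall>j\<in>{1..k}. norm (u k j) = 1)) \<and>
     (\<forall>v\<in>quadric_surface q.
        eval3 p v = c 0 + (\<Sum>k\<in>{1..d}. c k * (\<Prod>j\<in>{1..k}. u k j \<bullet> v)))"

definition multipole_tuples :: "nat \<Rightarrow> (nat \<Rightarrow> real ^ 3) set" where
  "multipole_tuples k = {1..k} \<rightarrow>\<^sub>E (UNIV - {0})"

text \<open>
  The orbit relation of the group generated by the permutations of the factors and the rescalings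
  with product \<open>1\<close>: every element of this semidirect product is a permutation followed by
  a rescaling.
\<close>

definition multipole_rel :: "nat \<Rightarrow> ((nat \<Rightarrow> real ^ 3) \<times> (nat \<Rightarrow> real ^ 3)) set" where
  "multipole_rel k = {(s, t). s \<in> multipole_tuples k \<and> t \<in> multipole_tuples k \<and>
     (\<exists>\<sigma> \<mu>. \<sigma> permutes {1..k} \<and> (\<Prod>j\<in>{1..k}. \<mu> j) = (1::real) \<and>
            (\<forall>j\<in>{1..k}. t j = \<mu> j *\<^sub>R s (\<sigma> j)))}"

type_synonym multipole = "(nat \<Rightarrow> real ^ 3) set"

definition multipole_space :: "nat \<Rightarrow> multipole set" where
  "multipole_space k = multipole_tuples k // multipole_rel k"

text \<open>\<open>None\<close> plays the role of the zero multipole.\<close>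

definition extended_multipole_space :: "nat \<Rightarrow> multipole option set" where
  "extended_multipole_space k = insert None (Some ` multipole_space k)"

text \<open>
  For \<open>k \<ge> 1\<close>, the multipole corresponding to the product of a scalar \<open>a\<close> and the linear forms
  \<open>s 1, \<dots>, s k\<close>. If \<open>a \<noteq> 0\<close>, the scalar is absorbed into the first factor; absorbing it into other
  factors gives the same class.
\<close>

definition associated_multipole :: "nat \<Rightarrow> real \<Rightarrow> (nat \<Rightarrow> real ^ 3) \<Rightarrow> multipole option" where
  "associated_multipole k a s =
     (if a = 0 then None
      else Some (multipole_rel k `` {\<lambda>j\<in>{1..k}. if j = 1 then a *\<^sub>R s j else s j}))"

lemma multipole_rel_prod:
  assumes "(s, t) \<in> multipole_rel k"
  shows "(\<Prod>j\<in>{1..k}. s j \<bullet> v) = (\<Prod>j\<in>{1..k}. t j \<bullet> v)"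
proof -
  from assms obtain \<sigma> \<mu> where p: "\<sigma> permutes {1..k}" and m: "(\<Prod>j\<in>{1..k}. \<mu> j) = (1::real)"
    and t: "\<And>j. j \<in> {1..k} \<Longrightarrow> t j = \<mu> j *\<^sub>R s (\<sigma> j)"
    by (auto simp: multipole_rel_def)
  have "(\<Prod>j\<in>{1..k}. t j \<bullet> v) = (\<Prod>j\<in>{1..k}. \<mu> j * (s (\<sigma> j) \<bullet> v))"
    by (rule prod.cong) (simp_all add: t)
  also have "\<dots> = (\<Prod>j\<in>{1..k}. s (\<sigma> j) \<bullet> v)"
    by (simp only: prod.distrib m mult_1)
  also have "\<dots> = (\<Prod>j\<in>{1..k}. s j \<bullet> v)"
    using prod.permute[OF p, of "\<lambda>j. s j \<bullet> v"] by (simp add: comp_def)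
  finally show ?thesis by simp
qed

lemma associated_multipole_prod:
  assumes "k \<ge> 1" "associated_multipole k a s = Some w" "t \<in> w"
  shows "(\<Prod>j\<in>{1..k}. t j \<bullet> v) = a * (\<Prod>j\<in>{1..k}. s j \<bullet> v)"
proof -
  let ?r = "\<lambda>j\<in>{1..k}. if j = 1 then a *\<^sub>R s j else s j"
  have "(?r, t) \<in> multipole_rel k"
    using assms by (auto simp: associated_multipole_def split: if_splits)
  then have "(\<Prod>j\<in>{1..k}. t j \<bullet> v) = (\<Prod>j\<in>{1..k}. ?r j \<bullet> v)"
    by (simp only: multipole_rel_prod)
  also have "\<dots> = (\<Prod>j\<in>{1..k}. (if j = 1 then a else 1) * (s j \<bullet> v))"
    by (rule prod.cong) auto
  also have "\<dots> = a * (\<Prod>j\<in>{1..k}. s j \<bullet> v)"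
    using assms(1) by (simp add: prod.distrib prod.delta)
  finally show ?thesis .
qed

end

theory Submission
  imports Defs "HOL-Computational_Algebra.Fundamental_Theorem_Algebra"
begin

text \<open>
  Existence. It suffices to write every form of degree \<open>n\<close>, restricted to the surface \<open>Q = 1\<close>, as
  a product of \<open>n\<close> real linear forms plus a polynomial of degree below \<open>n\<close>; this is the property
  \<open>splits_on\<close>, and descending through the degrees gives the representation
  (\<open>splits_on_representation\<close>). A multiple \<open>Q r\<close> of the quadratic form agrees with \<open>r\<close> on the
  surface and so has dropped degree by two. Only the restriction of a form to the cone \<open>Q = 0\<close>
  therefore matters. This cone is a conic, hence a rational curve on which a form of degree \<open>n\<close>
  is a binary form of degree \<open>2 n\<close>. Two points of the conic span the zero set of one linear form,
  so a factorization amounts to grouping the \<open>2 n\<close> zeros into pairs, each of which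
  defines a real line.

  Irreducibility of \<open>Q\<close> over the complex numbers makes it non-degenerate
  (\<open>irreducible_quadratic_form_nondegenerate\<close>), and there are three cases. If the surface is empty,
  there is nothing to prove. If \<open>Q\<close> is positive definite, the surface is a sphere in suitable
  coordinates. The conic then has no real points, the zeros of a real form come in conjugate pairs,
  and each pair defines a real line (\<open>splits_on_sphere\<close>). If \<open>Q\<close> has a non-zero real isotropic
  vector, it is proportional to \<open>x z - y\<^sup>2\<close> in suitable coordinates. The conic is parametrized by
  \<open>(1, t, t\<^sup>2)\<close>, linear forms become arbitrary real polynomials of degree at most two in \<open>t\<close>, and
  real polynomials are products of such (\<open>splits_on_hyperboloid\<close>).

  Uniqueness. Let the surface be the image of the unit sphere under \<open>s \<mapsto> x0 + f s\<close>. Each circle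
  \<open>cos \<theta> e1 + sin \<theta> e2\<close> on the sphere turns an identity between two representations into an
  identity between polynomials in \<open>cis \<theta>\<close>. Its lowest coefficient contains only the leading products,
  evaluated at the complex null vector \<open>e1 + \<i> e2\<close> (\<open>ellipsoid_leading_terms\<close>). So the two leading
  products agree on the null cone. A real linear form is determined up to a factor by a single
  zero on the null cone, because it also vanishes at the conjugate point. Hence the factors can be
  matched one by one (\<open>null_poly_unique_factorization\<close>). The normalization to unit vectors and
  non-negative scalars fixes the remaining factors, the leading terms cancel, and induction on the
  degree finishes the argument (\<open>ellipsoid_uniqueness\<close>).
\<close>

section \<open>Forms and polynomial functions of bounded degree\<close>

definition cdot :: "real ^ 3 \<Rightarrow> complex ^ 3 \<Rightarrow> complex" where
  "cdot u a = (\<Sum>i\<in>UNIV. of_real (u $ i) * a $ i)"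

text \<open>
  The function \<open>f\<close> is a real form of degree \<open>n\<close>, and \<open>F\<close> is the same polynomial on complex vectors.
  Splitting off one variable at a time, instead of listing coefficients, turns each normal form below
  into an induction on the degree. The complex partner is carried along because the zeros that are
  needed are complex.
\<close>

primrec homog :: "nat \<Rightarrow> (real ^ 3 \<Rightarrow> real) \<Rightarrow> (complex ^ 3 \<Rightarrow> complex) \<Rightarrow> bool" where
  "homog 0 f F = (\<exists>c. f = (\<lambda>_. c) \<and> F = (\<lambda>_. of_real c))"
| "homog (Suc n) f F = (\<exists>g G. (\<forall>i. homog n (g i) (G i)) \<and>
     f = (\<lambda>v. \<Sum>i\<in>UNIV. v $ i * g i v) \<and> F = (\<lambda>v. \<Sum>i\<in>UNIV. v $ i * G i v))"

lemma homog_add: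
  "homog n f F \<Longrightarrow> homog n g G \<Longrightarrow> homog n (\<lambda>v. f v + g v) (\<lambda>v. F v + G v)"
proof (induction n arbitrary: f F g G)
  case 0
  then show ?case by fastforce
next
  case (Suc n)
  obtain f' F' where 1: "\<forall>i. homog n (f' i) (F' i)"
    "f = (\<lambda>v. \<Sum>i\<in>UNIV. v $ i * f' i v)" "F = (\<lambda>v. \<Sum>i\<in>UNIV. v $ i * F' i v)"
    using Suc.prems(1) by auto
  obtain g' G' where 2: "\<forall>i. homog n (g' i) (G' i)"
    "g = (\<lambda>v. \<Sum>i\<in>UNIV. v $ i * g' i v)" "G = (\<lambda>v. \<Sum>i\<in>UNIV. v $ i * G' i v)"
    using Suc.prems(2) by auto
  have "\<forall>i. homog n (\<lambda>v. f' i v + g' i v) (\<lambda>v. F' i v + G' i v)"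
    using 1(1) 2(1) Suc.IH by blast
  then show ?case
    unfolding homog.simps 1(2,3) 2(2,3)
    by (intro exI[of _ "\<lambda>i v. f' i v + g' i v"] exI[of _ "\<lambda>i v. F' i v + G' i v"])
       (auto simp: sum.distrib distrib_left)
qed

lemma homog_scale: "homog n f F \<Longrightarrow> homog n (\<lambda>v. c * f v) (\<lambda>v. of_real c * F v)"
proof (induction n arbitrary: f F)
  case 0
  then show ?case by fastforce
next
  case (Suc n)
  obtain f' F' where 1: "\<forall>i. homog n (f' i) (F' i)"
    "f = (\<lambda>v. \<Sum>i\<in>UNIV. v $ i * f' i v)" "F = (\<lambda>v. \<Sum>i\<in>UNIV. v $ i * F' i v)"
    using Suc.prems(1) by auto
  have "\<forall>i. homog n (\<lambda>v. c * f' i v) (\<lambda>v. of_real c * F' i v)"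
    using 1(1) Suc.IH by blast
  then show ?case
    unfolding homog.simps 1(2,3)
    by (intro exI[of _ "\<lambda>i v. c * f' i v"] exI[of _ "\<lambda>i v. of_real c * F' i v"])
       (auto simp: sum_distrib_left mult_ac)
qed

lemma homog_linear_mult:
  assumes "homog n f F"
  shows "homog (Suc n) (\<lambda>v. (w \<bullet> v) * f v) (\<lambda>a. cdot w a * F a)"
  unfolding homog.simps
proof (intro exI conjI allI)
  show "homog n (\<lambda>v. w $ i * f v) (\<lambda>a. of_real (w $ i) * F a)" for i
    by (rule homog_scale[OF assms])
qed (auto simp: inner_vec_def cdot_def sum_distrib_left sum_distrib_right mult_ac)

lemma homog_homogeneous:
  "homog n f F \<Longrightarrow> F (\<chi> i. c * a $ i) = c ^ n * F a"
proof (induction n arbitrary: f F)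
  case 0
  then show ?case by auto
next
  case (Suc n)
  obtain f' F' where 1: "\<forall>i. homog n (f' i) (F' i)" "F = (\<lambda>v. \<Sum>i\<in>UNIV. v $ i * F' i v)"
    using Suc.prems(1) by auto
  have "F' i (\<chi> i. c * a $ i) = c ^ n * F' i a" for i
    using 1(1) Suc.IH by blast
  then show ?case
    unfolding 1(2) by (simp add: sum_distrib_left mult_ac)
qed

definition form :: "nat \<Rightarrow> (real ^ 3 \<Rightarrow> real) \<Rightarrow> bool" where
  "form n f \<longleftrightarrow> (\<exists>F. homog n f F)"

lemma form_const: "form 0 (\<lambda>_. c)"
  by (auto simp: form_def)

lemma form_add: "form n f \<Longrightarrow> form n g \<Longrightarrow> form n (\<lambda>v. f v + g v)"
  unfolding form_def using homog_add by blast

lemma form_scale: "form n f \<Longrightarrow> form n (\<lambda>v. c * f v)"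
  unfolding form_def using homog_scale by blast

lemma form_linear_mult: "form n f \<Longrightarrow> form (Suc n) (\<lambda>v. (w \<bullet> v) * f v)"
  unfolding form_def using homog_linear_mult by blast

lemma form_coord_mult: "form n f \<Longrightarrow> form (Suc n) (\<lambda>v. v $ i * f v)"
  using form_linear_mult[of n f "axis i 1"] by (simp add: inner_axis')

lemma form_coord_power_mult: "form n f \<Longrightarrow> form (k + n) (\<lambda>v. v $ i ^ k * f v)"
  by (induction k) (auto dest: form_coord_mult simp: mult_ac)

lemma form_linear_power_mult: "form n f \<Longrightarrow> form (k + n) (\<lambda>v. (w \<bullet> v) ^ k * f v)"
  by (induction k) (auto dest: form_linear_mult simp: mult_ac)

lemma form_zero: "form n (\<lambda>_. 0)"
proof (induction n)
  case 0
  show ?case by (rule form_const)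
next
  case (Suc n)
  show ?case using form_coord_mult[OF Suc, of undefined] by simp
qed

lemma form_sum: "(\<And>i. i \<in> A \<Longrightarrow> form n (f i)) \<Longrightarrow> form n (\<lambda>v. \<Sum>i\<in>A. f i v)"
  by (induction A rule: infinite_finite_induct) (auto intro: form_zero form_add)

lemma form_Suc:
  assumes "form (Suc n) f"
  obtains g where "\<And>i. form n (g i)" "f = (\<lambda>v. \<Sum>i\<in>UNIV. v $ i * g i v)"
proof -
  obtain g G where "\<forall>i. homog n (g i) (G i)" "f = (\<lambda>v. \<Sum>i\<in>UNIV. v $ i * g i v)"
    using assms unfolding form_def homog.simps by blast
  then show thesis using that[of g] unfolding form_def by blast
qed

lemma form_0:
  assumes "form 0 f"
  obtains c where "f = (\<lambda>_. c)"
proof -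
  from assms have "\<exists>c. f = (\<lambda>_. c)" unfolding form_def homog.simps by blast
  then show thesis using that by blast
qed

lemma form_linear_prod: "form n (\<lambda>v. \<Prod>j\<in>{1..n}. w j \<bullet> v)"
proof (induction n)
  case 0
  show ?case by (simp add: form_const)
next
  case (Suc n)
  have "form (Suc n) (\<lambda>v. (w (Suc n) \<bullet> v) * (\<Prod>j\<in>{1..n}. w j \<bullet> v))"
    by (rule form_linear_mult[OF Suc])
  then show ?case by (simp add: mult.commute)
qed

lemma form_compose_linear:
  fixes T :: "real ^ 3 \<Rightarrow> real ^ 3"
  assumes "linear T" "form n f"
  shows "form n (\<lambda>v. f (T v))"
  using assms(2)
proof (induction n arbitrary: f)
  case 0
  then show ?case by (auto elim: form_0 intro: form_const)
next
  case (Suc n)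
  obtain g where g: "\<And>i. form n (g i)" "f = (\<lambda>v. \<Sum>i\<in>UNIV. v $ i * g i v)"
    using Suc.prems by (rule form_Suc) blast
  have T: "T v $ i = adjoint T (axis i 1) \<bullet> v" for v i
    using adjoint_clauses(2)[OF assms(1), of "axis i 1" v] by (simp add: inner_axis')
  show ?case unfolding g(2) T
    by (intro form_sum form_linear_mult Suc.IH g(1))
qed

text \<open>
  The bound on the degree is strict so that the remainders left by forms of degree \<open>n\<close> are described
  by the same \<open>n\<close>, with the zero function as the only remainder for \<open>n = 0\<close>.
\<close>

primrec below :: "nat \<Rightarrow> (real ^ 3 \<Rightarrow> real) \<Rightarrow> bool" where
  "below 0 f = (f = (\<lambda>_. 0))"
| "below (Suc n) f = (\<exists>h r. form n h \<and> below n r \<and> f = (\<lambda>v. h v + r v))"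

lemma below_zero: "below n (\<lambda>_. 0)"
proof (induction n)
  case (Suc n)
  then show ?case unfolding below.simps
    by (intro exI[of _ "\<lambda>_. 0"]) (auto intro: form_zero)
qed simp

lemma below_add: "below n f \<Longrightarrow> below n g \<Longrightarrow> below n (\<lambda>v. f v + g v)"
proof (induction n arbitrary: f g)
  case 0
  then show ?case by auto
next
  case (Suc n)
  from Suc.prems obtain f1 f2 g1 g2 where
    "form n f1" "below n f2" "f = (\<lambda>v. f1 v + f2 v)"
    "form n g1" "below n g2" "g = (\<lambda>v. g1 v + g2 v)" by auto
  then show ?case using form_add Suc.IH
    unfolding below.simps
    by (intro exI[of _ "\<lambda>v. f1 v + g1 v"] exI[of _ "\<lambda>v. f2 v + g2 v"]) (auto simp: add_ac)
qed

lemma below_scale: "below n f \<Longrightarrow> below n (\<lambda>v. c * f v)"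
proof (induction n arbitrary: f)
  case 0
  then show ?case by auto
next
  case (Suc n)
  from Suc.prems obtain f1 f2 where
    "form n f1" "below n f2" "f = (\<lambda>v. f1 v + f2 v)" by auto
  then show ?case using form_scale Suc.IH
    unfolding below.simps
    by (intro exI[of _ "\<lambda>v. c * f1 v"] exI[of _ "\<lambda>v. c * f2 v"]) (auto simp: distrib_left)
qed

lemma below_diff: "below n f \<Longrightarrow> below n g \<Longrightarrow> below n (\<lambda>v. f v - g v)"
  using below_add[OF _ below_scale, of n f g "-1"] by simp

lemma below_linear_mult: "below n f \<Longrightarrow> below (Suc n) (\<lambda>v. (w \<bullet> v) * f v)"
proof (induction n arbitrary: f)
  case 0
  then show ?case using below_zero[of 1] by simp
next
  case (Suc n)
  from Suc.prems obtain f1 f2 where f: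
    "form n f1" "below n f2" "f = (\<lambda>v. f1 v + f2 v)" by auto
  show ?case unfolding f(3) below.simps(2)[of "Suc n"]
    using form_linear_mult[OF f(1)] Suc.IH[OF f(2)]
    by (intro exI[of _ "\<lambda>v. (w \<bullet> v) * f1 v"] exI[of _ "\<lambda>v. (w \<bullet> v) * f2 v"])
       (auto simp: distrib_left)
qed

lemma below_coord_mult: "below n f \<Longrightarrow> below (Suc n) (\<lambda>v. v $ i * f v)"
  using below_linear_mult[of n f "axis i 1"] by (simp add: inner_axis')

lemma below_sum: "(\<And>i. i \<in> A \<Longrightarrow> below n (f i)) \<Longrightarrow> below n (\<lambda>v. \<Sum>i\<in>A. f i v)"
  by (induction A rule: infinite_finite_induct) (auto intro: below_zero below_add)

lemma form_below: "form k f \<Longrightarrow> k < n \<Longrightarrow> below n f"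
proof (induction n)
  case 0
  then show ?case by simp
next
  case (Suc n)
  show ?case
  proof (cases "k = n")
    case True
    then show ?thesis using Suc.prems below_zero
      unfolding below.simps by (intro exI[of _ f] exI[of _ "\<lambda>_. 0"]) auto
  next
    case False
    then have "below n f" using Suc by simp
    then show ?thesis using form_zero
      unfolding below.simps by (intro exI[of _ "\<lambda>_. 0"] exI[of _ f]) auto
  qed
qed

lemma below_compose_linear:
  fixes T :: "real ^ 3 \<Rightarrow> real ^ 3"
  assumes "linear T" "below n f"
  shows "below n (\<lambda>v. f (T v))"
  using assms(2)
proof (induction n arbitrary: f)
  case 0
  then show ?case by auto
next
  case (Suc n)
  from Suc.prems obtain f1 f2 where f:
    "form n f1" "below n f2" "f = (\<lambda>v. f1 v + f2 v)" by auto
  show ?case unfolding f(3) below.simps(2)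
    using form_compose_linear[OF assms(1) f(1)] Suc.IH[OF f(2)] by blast
qed


section \<open>Splitting forms into linear factors on a surface\<close>

text \<open>
  The vectors \<open>w j\<close> may be zero and \<open>c\<close> may be negative; this leaves the property invariant under
  linear maps, and the normalization can wait until the end.
\<close>

definition splits_on :: "(real ^ 3) set \<Rightarrow> bool" where
  "splits_on S \<longleftrightarrow> (\<forall>n h. form n h \<longrightarrow>
     (\<exists>c w r. below n r \<and> (\<forall>v\<in>S. h v = c * (\<Prod>j\<in>{1..n}. w j \<bullet> v) + r v)))"

text \<open>
  The remainder left by the form of top degree joins the terms of lower degree, which are then
  treated in the same way.
\<close>

lemma splits_on_representation:
  assumes S: "splits_on S" and "below (Suc d) f"
  shows "\<exists>c w. \<forall>v\<in>S. f v = c 0 + (\<Sum>k\<in>{1..d}. c k * (\<Prod>j\<in>{1..k}. w k j \<bullet> v))"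
  using assms(2)
proof (induction d arbitrary: f)
  case 0
  then have "form 0 f" by auto
  then obtain c where "f = (\<lambda>_. c)" by (rule form_0)
  then show ?case by (intro exI[of _ "\<lambda>_. c"]) simp
next
  case (Suc d)
  then obtain h r where hr: "form (Suc d) h" "below (Suc d) r" "f = (\<lambda>v. h v + r v)"
    unfolding below.simps(2)[of "Suc d"] by blast
  obtain c0 w0 r0 where 1: "below (Suc d) r0"
    "\<And>v. v \<in> S \<Longrightarrow> h v = c0 * (\<Prod>j\<in>{1..Suc d}. w0 j \<bullet> v) + r0 v"
    using S hr(1) unfolding splits_on_def by blast
  obtain c w where 2: "\<And>v. v \<in> S \<Longrightarrow>
      r0 v + r v = c 0 + (\<Sum>k\<in>{1..d}. c k * (\<Prod>j\<in>{1..k}. w k j \<bullet> v))"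
    using Suc.IH[OF below_add[OF 1(1) hr(2)]] by blast
  let ?c = "c(Suc d := c0)" and ?w = "w(Suc d := w0)"
  have "f v = ?c 0 + (\<Sum>k\<in>{1..Suc d}. ?c k * (\<Prod>j\<in>{1..k}. ?w k j \<bullet> v))" if "v \<in> S" for v
  proof -
    have "(\<Sum>k\<in>{1..d}. ?c k * (\<Prod>j\<in>{1..k}. ?w k j \<bullet> v)) =
          (\<Sum>k\<in>{1..d}. c k * (\<Prod>j\<in>{1..k}. w k j \<bullet> v))"
      by (rule sum.cong) auto
    then show ?thesis using 1(2)[OF that] 2[OF that] unfolding hr(3) by simp
  qed
  then show ?case by (intro exI[of _ ?c] exI[of _ ?w] ballI)
qed

lemma splits_on_image:
  fixes T :: "real ^ 3 \<Rightarrow> real ^ 3"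
  assumes "linear T" "inj T" "splits_on S"
  shows "splits_on (T ` S)"
  unfolding splits_on_def
proof (intro allI impI)
  fix n h assume h: "form n h"
  obtain T' where T': "linear T'" "\<And>v. T' (T v) = v"
    using linear_injective_left_inverse[OF assms(1,2)] by (auto simp: fun_eq_iff)
  obtain c w r where 1: "below n r"
    "\<And>v. v \<in> S \<Longrightarrow> h (T v) = c * (\<Prod>j\<in>{1..n}. w j \<bullet> v) + r v"
    using assms(3) form_compose_linear[OF assms(1) h] unfolding splits_on_def by blast
  have "h v = c * (\<Prod>j\<in>{1..n}. adjoint T' (w j) \<bullet> v) + r (T' v)" if "v \<in> T ` S" for v
    using that 1(2) T'(2) by (auto simp: adjoint_clauses(2)[OF T'(1)])
  then show "\<exists>c w r. below n r \<and> (\<forall>v\<in>T ` S. h v = c * (\<Prod>j\<in>{1..n}. w j \<bullet> v) + r v)"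
    using below_compose_linear[OF T'(1) 1(1)]
    by (intro exI[of _ c] exI[of _ "\<lambda>j. adjoint T' (w j)"] exI[of _ "\<lambda>v. r (T' v)"]) blast
qed

section \<open>The unit sphere and its complex null cone\<close>

unbundle cross3_syntax

text \<open>
  The real and imaginary parts of a complex vector of square zero are orthogonal and of equal length.
\<close>

lemma null_vector_frame:
  fixes a :: "complex ^ 3"
  assumes "(\<Sum>i\<in>UNIV. (a $ i)\<^sup>2) = 0" "a \<noteq> 0"
  obtains r e f where "r > 0" "norm e = 1" "norm f = 1" "e \<bullet> f = 0"
    "a = (\<chi> i. of_real r * (of_real (e $ i) + \<i> * of_real (f $ i)))"
proof -
  define x y where "x = (\<chi> i. Re (a $ i))" and "y = (\<chi> i. Im (a $ i))"
  have a: "a $ i = of_real (x $ i) + \<i> * of_real (y $ i)" for i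
    by (simp add: x_def y_def complex_eq_iff)
  have "Re (\<Sum>i\<in>UNIV. (a $ i)\<^sup>2) = x \<bullet> x - y \<bullet> y" "Im (\<Sum>i\<in>UNIV. (a $ i)\<^sup>2) = 2 * (x \<bullet> y)"
    by (simp_all add: a inner_vec_def sum_subtractf sum_distrib_left power2_eq_square mult_ac)
  then have xy: "x \<bullet> x = y \<bullet> y" "x \<bullet> y = 0"
    using assms(1) by simp_all
  have "x \<noteq> 0"
  proof
    assume "x = 0"
    then have "y = 0" using xy by simp
    then have "a = 0" using \<open>x = 0\<close> by (simp add: vec_eq_iff a)
    then show False using assms(2) by simp
  qed
  then have r: "norm x > 0" "norm y = norm x"
    using xy(1) by (auto simp: norm_eq)
  show thesis
  proof (rule that)
    show "norm (x /\<^sub>R norm x) = 1" "norm (y /\<^sub>R norm x) = 1" using r by simp_all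
    show "(x /\<^sub>R norm x) \<bullet> (y /\<^sub>R norm x) = 0" using xy by simp
    show "a = (\<chi> i. of_real (norm x) * (of_real ((x /\<^sub>R norm x) $ i) + \<i> * of_real ((y /\<^sub>R norm x) $ i)))"
      using r(1) by (simp add: vec_eq_iff a field_simps)
  qed (rule r(1))
qed

lemma orthonormal_pair_cross:
  fixes e f :: "real ^ 3"
  assumes "norm e = 1" "norm f = 1" "e \<bullet> f = 0"
  shows "norm (e \<times> f) = 1"
  using norm_cross_dot[of e f] assms norm_ge_zero[of "e \<times> f"] by (simp add: power2_eq_1_iff)

text \<open>
  The difference \<open>d\<close> of the two sides is orthogonal to \<open>e\<close> and \<open>f\<close>, so the triple product
  \<open>(e \<times> f) \<times> d\<close> vanishes; \<open>d\<close> is also orthogonal to \<open>e \<times> f\<close>, which leaves only \<open>d = 0\<close>.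
\<close>

lemma orthonormal_expansion:
  fixes e f v :: "real ^ 3"
  assumes "norm e = 1" "norm f = 1" "e \<bullet> f = 0"
  shows "v = (e \<bullet> v) *\<^sub>R e + (f \<bullet> v) *\<^sub>R f + ((e \<times> f) \<bullet> v) *\<^sub>R (e \<times> f)"
proof -
  define n where "n = e \<times> f"
  have inn: "e \<bullet> e = 1" "f \<bullet> f = 1" "n \<bullet> n = 1" "f \<bullet> e = 0" "e \<bullet> n = 0" "f \<bullet> n = 0" "n \<bullet> e = 0" "n \<bullet> f = 0"
    using assms orthonormal_pair_cross[OF assms]
    by (simp_all add: n_def dot_cross_self inner_commute norm_eq_1)
  define d where "d = v - ((e \<bullet> v) *\<^sub>R e + (f \<bullet> v) *\<^sub>R f + (n \<bullet> v) *\<^sub>R n)"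
  have d: "e \<bullet> d = 0" "f \<bullet> d = 0" "n \<bullet> d = 0"
    using assms(3) by (simp_all add: d_def inner_diff_right inner_add_right inn)
  have "(e \<times> f) \<times> d = (e \<bullet> d) *\<^sub>R f - (f \<bullet> d) *\<^sub>R e"
    by (simp add: cross3_simps forall_3)
  then have "n \<times> d = 0" by (simp add: d n_def)
  then have "n = 0 \<or> d = 0" using d(3) norm_and_cross_eq_0 by blast
  then show ?thesis using inn(3) by (auto simp: d_def n_def)
qed

lemma orthonormal_parseval:
  fixes e f v :: "real ^ 3"
  assumes "norm e = 1" "norm f = 1" "e \<bullet> f = 0"
  shows "v \<bullet> v = (e \<bullet> v)\<^sup>2 + (f \<bullet> v)\<^sup>2 + ((e \<times> f) \<bullet> v)\<^sup>2"
proof -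
  have "v \<bullet> v = v \<bullet> ((e \<bullet> v) *\<^sub>R e + (f \<bullet> v) *\<^sub>R f + ((e \<times> f) \<bullet> v) *\<^sub>R (e \<times> f))"
    using orthonormal_expansion[OF assms, of v] by simp
  also have "\<dots> = (e \<bullet> v)\<^sup>2 + (f \<bullet> v)\<^sup>2 + ((e \<times> f) \<bullet> v)\<^sup>2"
    by (simp only: inner_add_right inner_scaleR_right power2_eq_square inner_commute[of v])
  finally show ?thesis .
qed

text \<open>
  The defining decomposition along the coordinates, rewritten in the orthonormal coordinates \<open>e\<close>,
  \<open>f\<close>, \<open>e \<times> f\<close>. At the null vector \<open>e + \<i> f\<close> these coordinates take the values \<open>1\<close>, \<open>\<i>\<close> and
  \<open>0\<close>.
\<close>

lemma homog_frame_decomposition: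
  assumes ef: "norm e = 1" "norm f = 1" "e \<bullet> f = 0" and h: "homog (Suc n) h H"
  obtains h1 H1 h2 H2 h3 where "homog n h1 H1" "homog n h2 H2" "form n h3"
    "\<And>v. h v = (e \<bullet> v) * h1 v + (f \<bullet> v) * h2 v + ((e \<times> f) \<bullet> v) * h3 v"
    "H (\<chi> i. of_real (e $ i) + \<i> * of_real (f $ i)) =
     H1 (\<chi> i. of_real (e $ i) + \<i> * of_real (f $ i)) + \<i> * H2 (\<chi> i. of_real (e $ i) + \<i> * of_real (f $ i))"
proof -
  let ?a = "\<chi> i. of_real (e $ i) + \<i> * of_real (f $ i)"
  obtain g G where g: "\<And>i. homog n (g i) (G i)"
    and h: "h = (\<lambda>v. \<Sum>i\<in>UNIV. v $ i * g i v)" and H: "H = (\<lambda>v. \<Sum>i\<in>UNIV. v $ i * G i v)"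
    using h by auto
  define k where "k u v = u $ 1 * g 1 v + u $ 2 * g 2 v + u $ 3 * g 3 v" for u :: "real ^ 3" and v
  define K where "K u v = of_real (u $ 1) * G 1 v + of_real (u $ 2) * G 2 v + of_real (u $ 3) * G 3 v" for u :: "real ^ 3" and v
  have kK: "homog n (k u) (K u)" for u
    unfolding k_def K_def by (intro homog_add homog_scale g)
  show thesis
  proof (rule that)
    show "homog n (k e) (K e)" "homog n (k f) (K f)" "form n (k (e \<times> f))"
      using kK by (auto simp: form_def)
    show "h v = (e \<bullet> v) * k e v + (f \<bullet> v) * k f v + ((e \<times> f) \<bullet> v) * k (e \<times> f) v" for v
    proof -
      have c: "v $ i = (e \<bullet> v) * e $ i + (f \<bullet> v) * f $ i + ((e \<times> f) \<bullet> v) * (e \<times> f) $ i" for i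
        by (subst orthonormal_expansion[OF ef, of v]) simp
      have "h v = v $ 1 * g 1 v + v $ 2 * g 2 v + v $ 3 * g 3 v"
        by (simp add: h sum_3)
      also have "\<dots> = (e \<bullet> v) * k e v + (f \<bullet> v) * k f v + ((e \<times> f) \<bullet> v) * k (e \<times> f) v"
        unfolding k_def c[of 1] c[of 2] c[of 3] by (simp only: algebra_simps)
      finally show ?thesis .
    qed
    show "H ?a = K e ?a + \<i> * K f ?a"
      by (simp add: H K_def sum_3 algebra_simps)
  qed
qed

text \<open>
  On the sphere, the square of \<open>f \<bullet> v\<close> can be traded for the squares of the other two coordinates and
  a term of lower degree. Apart from multiples of the third coordinate, only two monomials survive,
  and their coefficients are the real and imaginary part of the value at the null vector \<open>e + \<i> f\<close>.
\<close>

lemma sphere_reduction: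
  assumes ef: "norm e = 1" "norm f = 1" "e \<bullet> f = 0" and "homog (Suc n) h H"
  shows "\<exists>\<alpha> \<beta> g r. form n g \<and> below (Suc n) r \<and>
     (\<forall>v\<in>sphere 0 1. h v = \<alpha> * (e \<bullet> v) ^ Suc n + \<beta> * ((f \<bullet> v) * (e \<bullet> v) ^ n)
        + ((e \<times> f) \<bullet> v) * g v + r v) \<and>
     H (\<chi> i. of_real (e $ i) + \<i> * of_real (f $ i)) = of_real \<alpha> + \<i> * of_real \<beta>"
  using assms(4)
proof (induction n arbitrary: h H)
  case 0
  obtain h1 H1 h2 H2 h3 where *: "homog 0 h1 H1" "homog 0 h2 H2" "form 0 h3"
    "\<And>v. h v = (e \<bullet> v) * h1 v + (f \<bullet> v) * h2 v + ((e \<times> f) \<bullet> v) * h3 v"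
    "H (\<chi> i. of_real (e $ i) + \<i> * of_real (f $ i)) =
     H1 (\<chi> i. of_real (e $ i) + \<i> * of_real (f $ i)) + \<i> * H2 (\<chi> i. of_real (e $ i) + \<i> * of_real (f $ i))"
    by (rule homog_frame_decomposition[OF ef 0]) (rule that)
  obtain \<alpha> \<beta> where c: "h1 = (\<lambda>_. \<alpha>)" "H1 = (\<lambda>_. of_real \<alpha>)" "h2 = (\<lambda>_. \<beta>)" "H2 = (\<lambda>_. of_real \<beta>)"
    using *(1,2) by auto
  show ?case
    using *(3-5) below_zero[of "Suc 0"]
    by (intro exI[of _ \<alpha>] exI[of _ \<beta>] exI[of _ h3] exI[of _ "\<lambda>_. 0"]) (simp add: c mult_ac)
next
  case (Suc n)
  let ?a = "\<chi> i. of_real (e $ i) + \<i> * of_real (f $ i)"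
  obtain h1 H1 h2 H2 h3 where *: "homog (Suc n) h1 H1" "homog (Suc n) h2 H2" "form (Suc n) h3"
    "\<And>v. h v = (e \<bullet> v) * h1 v + (f \<bullet> v) * h2 v + ((e \<times> f) \<bullet> v) * h3 v"
    "H ?a = H1 ?a + \<i> * H2 ?a"
    by (rule homog_frame_decomposition[OF ef Suc.prems]) (rule that)
  obtain \<alpha>1 \<beta>1 g1 r1 where 1: "form n g1" "below (Suc n) r1"
     "\<And>v. v \<in> sphere 0 1 \<Longrightarrow> h1 v = \<alpha>1 * (e \<bullet> v) ^ Suc n + \<beta>1 * ((f \<bullet> v) * (e \<bullet> v) ^ n)
        + ((e \<times> f) \<bullet> v) * g1 v + r1 v"
     "H1 ?a = of_real \<alpha>1 + \<i> * of_real \<beta>1"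
    using Suc.IH[OF *(1)] by blast
  obtain \<alpha>2 \<beta>2 g2 r2 where 2: "form n g2" "below (Suc n) r2"
     "\<And>v. v \<in> sphere 0 1 \<Longrightarrow> h2 v = \<alpha>2 * (e \<bullet> v) ^ Suc n + \<beta>2 * ((f \<bullet> v) * (e \<bullet> v) ^ n)
        + ((e \<times> f) \<bullet> v) * g2 v + r2 v"
     "H2 ?a = of_real \<alpha>2 + \<i> * of_real \<beta>2"
    using Suc.IH[OF *(2)] by blast
  let ?n = "e \<times> f"
  have en: "form n (\<lambda>v. (e \<bullet> v) ^ n)"
    using form_linear_power_mult[OF form_const[of 1], of n e] by simp
  define g where "g v = (((e \<bullet> v) * g1 v + (f \<bullet> v) * g2 v) + (- \<beta>2) * ((?n \<bullet> v) * (e \<bullet> v) ^ n)) + h3 v" for v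
  define r where "r v = ((e \<bullet> v) * r1 v + (f \<bullet> v) * r2 v) + \<beta>2 * (e \<bullet> v) ^ n" for v
  have g: "form (Suc n) g"
    unfolding g_def by (intro form_add form_linear_mult form_scale 1 2 * en)
  have r: "below (Suc (Suc n)) r"
    unfolding r_def
    by (intro below_add below_scale below_linear_mult 1 2 form_below[OF en]) simp
  have "h v = (\<alpha>1 - \<beta>2) * (e \<bullet> v) ^ Suc (Suc n) + (\<beta>1 + \<alpha>2) * ((f \<bullet> v) * (e \<bullet> v) ^ Suc n)
        + (?n \<bullet> v) * g v + r v" if "v \<in> sphere 0 1" for v
  proof -
    have "v \<bullet> v = 1" using that by (simp add: norm_eq_1)
    then have ff: "(f \<bullet> v)\<^sup>2 = 1 - (e \<bullet> v)\<^sup>2 - (?n \<bullet> v)\<^sup>2"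
      using orthonormal_parseval[OF ef, of v] by simp
    have "h v = \<alpha>1 * (e \<bullet> v) ^ Suc (Suc n) + (\<beta>1 + \<alpha>2) * ((f \<bullet> v) * (e \<bullet> v) ^ Suc n)
        + \<beta>2 * ((f \<bullet> v)\<^sup>2 * (e \<bullet> v) ^ n)
        + (?n \<bullet> v) * ((e \<bullet> v) * g1 v + (f \<bullet> v) * g2 v + h3 v) + ((e \<bullet> v) * r1 v + (f \<bullet> v) * r2 v)"
      unfolding *(4) 1(3)[OF that] 2(3)[OF that] by (simp add: algebra_simps power2_eq_square)
    also have "\<dots> = (\<alpha>1 - \<beta>2) * (e \<bullet> v) ^ Suc (Suc n) + (\<beta>1 + \<alpha>2) * ((f \<bullet> v) * (e \<bullet> v) ^ Suc n)
        + (?n \<bullet> v) * g v + r v"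
      unfolding ff g_def r_def by (simp add: algebra_simps power2_eq_square)
    finally show ?thesis .
  qed
  moreover have "H ?a = of_real (\<alpha>1 - \<beta>2) + \<i> * of_real (\<beta>1 + \<alpha>2)"
    unfolding *(5) 1(4) 2(4) by (simp add: complex_eq_iff)
  ultimately show ?case using g r
    by (intro exI[of _ "\<alpha>1 - \<beta>2"] exI[of _ "\<beta>1 + \<alpha>2"] exI[of _ g] exI[of _ r] conjI ballI)
qed

text \<open>
  The coefficient at \<open>2 * n\<close> is the value at the point \<open>b2\<close> at infinity of the curve.
\<close>

lemma homog_on_quadratic_curve:
  assumes "homog n f F"
  shows "\<exists>p. degree p \<le> 2 * n \<and>
    (\<forall>t. poly p t = F (\<chi> i. b0 $ i + t * b1 $ i + t\<^sup>2 * b2 $ i)) \<and> coeff p (2 * n) = F b2"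
  using assms
proof (induction n arbitrary: f F)
  case 0
  then obtain c where "F = (\<lambda>_. of_real c)" by auto
  then show ?case by (intro exI[of _ "[:of_real c:]"]) simp
next
  case (Suc n)
  obtain f' F' where 1: "\<And>i. homog n (f' i) (F' i)" "F = (\<lambda>v. \<Sum>i\<in>UNIV. v $ i * F' i v)"
    using Suc.prems by auto
  obtain q where q: "\<And>i. degree (q i) \<le> 2 * n"
    "\<And>i t. poly (q i) t = F' i (\<chi> i. b0 $ i + t * b1 $ i + t\<^sup>2 * b2 $ i)"
    "\<And>i. coeff (q i) (2 * n) = F' i b2"
  proof -
    have "\<forall>i. \<exists>q. degree q \<le> 2 * n \<and>
      (\<forall>t. poly q t = F' i (\<chi> i. b0 $ i + t * b1 $ i + t\<^sup>2 * b2 $ i)) \<and> coeff q (2 * n) = F' i b2"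
      by (intro allI Suc.IH[OF 1(1)])
    from choice[OF this] show ?thesis using that by blast
  qed
  define p where "p = (\<Sum>i\<in>UNIV. [:b0 $ i, b1 $ i, b2 $ i:] * q i)"
  have "degree ([:b0 $ i, b1 $ i, b2 $ i:] * q i) \<le> 2 * Suc n" for i
  proof -
    have "degree [:b0 $ i, b1 $ i, b2 $ i:] \<le> 2" by (simp add: degree_pCons_eq_if)
    then show ?thesis
      using degree_mult_le[of "[:b0 $ i, b1 $ i, b2 $ i:]" "q i"] q(1)[of i] by simp
  qed
  then have "degree p \<le> 2 * Suc n" unfolding p_def by (intro degree_sum_le) auto
  moreover have "poly p t = F (\<chi> i. b0 $ i + t * b1 $ i + t\<^sup>2 * b2 $ i)" for t
    by (simp add: p_def 1(2) poly_sum q(2) power2_eq_square algebra_simps)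
  moreover have "coeff p (2 * Suc n) = F b2"
  proof -
    have "coeff (q i) (Suc (2 * n)) = 0" "coeff (q i) (Suc (Suc (2 * n))) = 0" for i
      using q(1)[of i] by (simp_all add: coeff_eq_0)
    then show ?thesis
      by (simp add: p_def 1(2) coeff_sum q(3))
  qed
  ultimately show ?case by (intro exI[of _ p] conjI allI)
qed

text \<open>
  The parametrization \<open>((1 - t\<^sup>2) / 2, - \<i> (1 + t\<^sup>2) / 2, t)\<close> of the null cone \<open>x\<^sup>2 + y\<^sup>2 + z\<^sup>2 = 0\<close>
  up to scaling; the point \<open>t = \<infinity>\<close> is missing. It is spelled out as a quadratic curve so that
  \<open>homog_on_quadratic_curve\<close> applies.
\<close>

definition conic_point :: "complex \<Rightarrow> complex ^ 3" where
  "conic_point t = (\<chi> i. (vector [1 / 2, - \<i> / 2, 0] :: complex ^ 3) $ i +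
     t * (vector [0, 0, 1] :: complex ^ 3) $ i + t\<^sup>2 * (vector [- 1 / 2, - \<i> / 2, 0] :: complex ^ 3) $ i)"

lemma conic_point_nth:
  "conic_point t $ 1 = (1 - t\<^sup>2) / 2" "conic_point t $ 2 = - \<i> * (1 + t\<^sup>2) / 2" "conic_point t $ 3 = t"
  by (simp_all add: conic_point_def algebra_simps diff_divide_distrib add_divide_distrib)

lemma conic_point_null: "(\<Sum>i\<in>UNIV. (conic_point t $ i)\<^sup>2) = 0" 
  by (simp add: sum_3 conic_point_nth power2_eq_square field_simps)

lemma conic_point_nonzero: "conic_point t \<noteq> 0"
proof
  assume "conic_point t = 0"
  then have "conic_point t $ 1 = 0" "conic_point t $ 3 = 0" by simp_all
  then show False by (simp add: conic_point_nth)
qed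

text \<open>
  If the restriction to the parametrized null cone has no zero, it is constant, and then its coefficient
  of degree \<open>2 * Suc n\<close>, which is the value at the missing point at infinity, is zero.
\<close>

lemma homog_null_zero:
  assumes "homog (Suc n) h H"
  obtains a where "(\<Sum>i\<in>UNIV. (a $ i)\<^sup>2) = 0" "a \<noteq> 0" "H a = 0"
proof -
  let ?b = "vector [- 1 / 2, - \<i> / 2, 0] :: complex ^ 3"
  obtain p where p: "\<And>t. poly p t = H (conic_point t)" "coeff p (2 * Suc n) = H ?b"
    using homog_on_quadratic_curve[OF assms] unfolding conic_point_def by metis
  show thesis
  proof (cases "constant (poly p)")
    case True
    then have "degree p = 0" by (simp add: constant_degree)
    then have "H ?b = 0" using p(2) by (simp add: coeff_eq_0)
    moreover have "(\<Sum>i\<in>UNIV. (?b $ i)\<^sup>2) = 0"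
      by (simp add: sum_3 power_divide)
    moreover have "?b \<noteq> 0" by (simp add: vec_eq_iff exI[of _ 1])
    ultimately show thesis using that by blast
  next
    case False
    then obtain t where "poly p t = 0" using fundamental_theorem_of_algebra by blast
    then show thesis using that[OF conic_point_null[of t] conic_point_nonzero] p(1) by simp
  qed
qed

text \<open>
  A real form that vanishes at the null vector \<open>e + \<i> f\<close> also vanishes at its conjugate, and
  the linear form with coefficient vector \<open>e \<times> f\<close> vanishes at exactly these two points of the null
  cone. In terms of \<open>sphere_reduction\<close>: both exceptional monomials have coefficient zero, so this
  linear form splits off.
\<close>

theorem splits_on_sphere: "splits_on (sphere 0 1)"
  unfolding splits_on_def
proof (intro allI impI)
  fix n h assume "form n h"
  then show "\<exists>c w r. below n r \<and> (\<forall>v\<in>sphere 0 1. h v = c * (\<Prod>j\<in>{1..n}. w j \<bullet> v) + r v)"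
  proof (induction n arbitrary: h)
    case 0
    then obtain c where "h = (\<lambda>_. c)" by (rule form_0)
    then show ?case by (intro exI[of _ c] exI[of _ undefined] exI[of _ "\<lambda>_. 0"]) simp
  next
    case (Suc n)
    then obtain H where H: "homog (Suc n) h H" by (auto simp: form_def simp del: homog.simps)
    obtain a where a: "(\<Sum>i\<in>UNIV. (a $ i)\<^sup>2) = 0" "a \<noteq> 0" "H a = 0"
      using homog_null_zero[OF H] by blast
    obtain s e f where ef: "s > 0" "norm e = 1" "norm f = 1" "e \<bullet> f = 0"
      "a = (\<chi> i. of_real s * (of_real (e $ i) + \<i> * of_real (f $ i)))"
      by (rule null_vector_frame[OF a(1,2)])
    obtain \<alpha> \<beta> g r where r: "form n g" "below (Suc n) r"
     "\<And>v. v\<in>sphere 0 1 \<Longrightarrow> h v = \<alpha> * (e \<bullet> v) ^ Suc n + \<beta> * ((f \<bullet> v) * (e \<bullet> v) ^ n)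
        + ((e \<times> f) \<bullet> v) * g v + r v"
     "H (\<chi> i. of_real (e $ i) + \<i> * of_real (f $ i)) = of_real \<alpha> + \<i> * of_real \<beta>"
      using sphere_reduction[OF ef(2-4) H] by blast
    have "H a = of_real s ^ Suc n * H (\<chi> i. of_real (e $ i) + \<i> * of_real (f $ i))"
      using homog_homogeneous[OF H, of "of_real s" "\<chi> i. of_real (e $ i) + \<i> * of_real (f $ i)"]
      by (simp add: ef(5))
    then have "of_real \<alpha> + \<i> * of_real \<beta> = 0" using a(3) ef(1) r(4) by simp
    then have "\<alpha> = 0" "\<beta> = 0" by (simp_all add: complex_eq_iff)
    then have h: "h v = ((e \<times> f) \<bullet> v) * g v + r v" if "v \<in> sphere 0 1" for v
      using r(3)[OF that] by simp
    obtain c w q where q: "below n q" "\<And>v. v\<in>sphere 0 1 \<Longrightarrow> g v = c * (\<Prod>j\<in>{1..n}. w j \<bullet> v) + q v"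
      using Suc.IH[OF r(1)] by blast
    let ?w = "w(Suc n := e \<times> f)" and ?r = "\<lambda>v. ((e \<times> f) \<bullet> v) * q v + r v"
    have "below (Suc n) ?r"
      by (intro below_add below_linear_mult r q)
    moreover have "h v = c * (\<Prod>j\<in>{1..Suc n}. ?w j \<bullet> v) + ?r v" if "v \<in> sphere 0 1" for v
    proof -
      have "(\<Prod>j\<in>{1..n}. ?w j \<bullet> v) = (\<Prod>j\<in>{1..n}. w j \<bullet> v)" by (rule prod.cong) auto
      then show ?thesis unfolding h[OF that] q(2)[OF that] by (simp add: algebra_simps)
    qed
    ultimately show ?case by (intro exI[of _ c] exI[of _ ?w] exI[of _ ?r] conjI ballI)
  qed
qed

section \<open>The surfaces \<open>x z - y\<^sup>2 = s\<close>\<close>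

lemma map_poly_of_real_add:
  "map_poly of_real (p + q) = (map_poly of_real p + map_poly of_real q :: complex poly)"
  by (rule poly_eqI) (simp add: coeff_map_poly)

lemma map_poly_of_real_mult:
  "map_poly of_real (p * q) = (map_poly of_real p * map_poly of_real q :: complex poly)"
  by (rule poly_eqI) (simp add: coeff_map_poly coeff_mult)

lemma poly_map_poly_of_real:
  "poly (map_poly of_real p) (of_real x :: complex) = of_real (poly p x)"
  by (simp add: poly_altdef degree_map_poly coeff_map_poly)

text \<open>
  A complex root yields a linear factor if it is real and otherwise the quadratic factor with the two
  conjugate roots.
\<close>

lemma real_poly_low_degree_factor:
  fixes p :: "real poly"
  assumes "degree p > 0"
  shows "\<exists>q. q dvd p \<and> (degree q = 1 \<or> degree q = 2)"
proof -
  let ?C = "map_poly of_real :: real poly \<Rightarrow> complex poly"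
  have "degree (?C p) > 0"
    using assms by (simp add: degree_map_poly)
  then have "\<not> constant (poly (?C p))" by (simp add: constant_degree)
  then obtain z where z: "poly (?C p) z = 0" using fundamental_theorem_of_algebra by blast
  show ?thesis
  proof (cases "Im z = 0")
    case True
    then have "z = of_real (Re z)" by (simp add: complex_eq_iff)
    then have "of_real (poly p (Re z)) = (0 :: complex)"
      using z by (metis poly_map_poly_of_real)
    then have "[:- Re z, 1:] dvd p" by (simp add: poly_eq_0_iff_dvd)
    moreover have "degree [:- Re z, 1:] = 1" by simp
    ultimately show ?thesis by blast
  next
    case False
    define q where "q = [:(Re z)\<^sup>2 + (Im z)\<^sup>2, - 2 * Re z, 1:]"
    have q: "degree q = 2" "q \<noteq> 0" by (simp_all add: q_def)
    have qz: "poly (?C q) z = 0"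
      by (simp add: q_def complex_eq_iff map_poly_pCons) (simp add: power2_eq_square algebra_simps)
    define r where "r = p mod q"
    have "degree r \<le> 1"
      using degree_mod_less'[of q p] q by (cases "r = 0") (auto simp: r_def)
    then have r: "r = [:coeff r 0, coeff r 1:]"
      by (intro poly_eqI) (auto simp: coeff_pCons coeff_eq_0 split: nat.splits)
    have "p = q * (p div q) + r" by (simp add: r_def)
    then have "poly (?C r) z = 0"
      using z qz map_poly_of_real_add[of "q * (p div q)" r] map_poly_of_real_mult[of q "p div q"]
      by simp
    then have "of_real (coeff r 0) + z * of_real (coeff r 1) = 0"
      by (subst (asm) r) (simp add: map_poly_pCons)
    then have "Re z * coeff r 1 + coeff r 0 = 0" "Im z * coeff r 1 = 0"
      by (simp_all add: complex_eq_iff)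
    then have "coeff r 1 = 0" "coeff r 0 = 0" using False by auto
    then have "r = 0" using r by simp
    then have "q dvd p" by (simp add: r_def dvd_eq_mod_eq_0)
    then show ?thesis using q by blast
  qed
qed

lemma real_poly_quadratic_factor:
  fixes p :: "real poly"
  assumes "degree p \<ge> 2"
  shows "\<exists>q. q dvd p \<and> degree q = 2"
proof -
  obtain q where q: "q dvd p" "degree q = 1 \<or> degree q = 2"
    using real_poly_low_degree_factor[of p] assms by auto
  show ?thesis
  proof (cases "degree q = 2")
    case False
    obtain k where k: "p = q * k" using q(1) by blast
    have nz: "q \<noteq> 0" "k \<noteq> 0" using assms k by auto
    then have "degree k > 0" using False q(2) assms by (simp add: k degree_mult_eq)
    then obtain s where s: "s dvd k" "degree s = 1 \<or> degree s = 2"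
      using real_poly_low_degree_factor by blast
    show ?thesis
    proof (cases "degree s = 2")
      case True
      then show ?thesis using s(1) k by (intro exI[of _ s]) auto
    next
      assume "degree s \<noteq> 2"
      then have "degree (q * s) = 2"
        using False q(2) s nz by (subst degree_mult_eq) auto
      moreover have "q * s dvd p" using s(1) k by (simp add: mult_dvd_mono)
      ultimately show ?thesis by blast
    qed
  qed (use q in blast)
qed

text \<open>
  Factors of degree below two are allowed, so that a polynomial whose degree is smaller than \<open>2 * n\<close>
  can be filled up with constants. In the binary form of degree \<open>2 * n\<close> the missing degree corresponds
  to zeros at infinity.
\<close>

lemma real_poly_quadratic_factorization:
  fixes p :: "real poly"
  assumes "degree p \<le> 2 * n"
  shows "\<exists>c q. (\<forall>j. degree (q j) \<le> 2) \<and> p = smult c (\<Prod>j\<in>{1..n}. q j)"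
  using assms
proof (induction n arbitrary: p)
  case 0
  then obtain c where "p = [:c:]" by (auto elim: degree_eq_zeroE)
  then show ?case by (intro exI[of _ c] exI[of _ "\<lambda>_. 0"]) simp
next
  case (Suc n)
  have "\<exists>s k. p = s * k \<and> degree s \<le> 2 \<and> degree k \<le> 2 * n"
  proof (cases "degree p \<le> 1")
    case True
    then show ?thesis by (intro exI[of _ p] exI[of _ 1]) simp
  next
    case False
    then obtain s where s: "s dvd p" "degree s = 2"
      using real_poly_quadratic_factor[of p] by auto
    then obtain k where k: "p = s * k" by blast
    then have "s \<noteq> 0" "k \<noteq> 0" using False by auto
    then have "degree k \<le> 2 * n" using Suc.prems s(2) by (simp add: k degree_mult_eq)
    then show ?thesis using k s(2) by (intro exI[of _ s] exI[of _ k]) simp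
  qed
  then obtain s k where sk: "p = s * k" "degree s \<le> 2" "degree k \<le> 2 * n" by blast
  obtain c q where q: "\<And>j. degree (q j) \<le> 2" "k = smult c (\<Prod>j\<in>{1..n}. q j)"
    using Suc.IH[OF sk(3)] by blast
  have "(\<Prod>j\<in>{1..n}. (q(Suc n := s)) j) = (\<Prod>j\<in>{1..n}. q j)" by (rule prod.cong) auto
  then have "p = smult c (\<Prod>j\<in>{1..Suc n}. (q(Suc n := s)) j)"
    by (simp add: sk(1) q(2) mult.commute)
  then show ?case using q(1) sk(2) by (intro exI[of _ c] exI[of _ "q(Suc n := s)"]) auto
qed

text \<open>
  The monomial of degree \<open>n\<close> that restricts to \<open>t ^ m\<close> on the conic \<open>(1, t, t\<^sup>2)\<close> and
  has degree at most one in the second coordinate.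
\<close>

definition conic_monomial :: "nat \<Rightarrow> nat \<Rightarrow> real ^ 3 \<Rightarrow> real" where
  "conic_monomial n m v = v $ 1 ^ (n - (m + 1) div 2) * (v $ 2 ^ (m mod 2) * v $ 3 ^ (m div 2))"

lemma conic_monomial_x: "m \<le> 2 * n \<Longrightarrow> v $ 1 * conic_monomial n m v = conic_monomial (Suc n) m v"
  by (simp add: conic_monomial_def Suc_diff_le)

lemma conic_monomial_z: "v $ 3 * conic_monomial n m v = conic_monomial (Suc n) (m + 2) v"
  by (simp add: conic_monomial_def)

lemma conic_monomial_y:
  assumes "m \<le> 2 * n" "v $ 1 * v $ 3 - (v $ 2)\<^sup>2 = s"
  shows "v $ 2 * conic_monomial n m v = conic_monomial (Suc n) (m + 1) v -
    s * (if odd m then v $ 1 ^ (n - (m + 1) div 2) * v $ 3 ^ (m div 2) else 0)"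
proof (cases "odd m")
  case False
  then show ?thesis by (auto simp: conic_monomial_def elim!: evenE)
next
  case True
  then obtain i where i: "m = 2 * i + 1" by (elim oddE)
  then have n: "n - i = Suc (n - Suc i)" using assms(1) by simp
  have y: "(v $ 2)\<^sup>2 = v $ 1 * v $ 3 - s" using assms(2) by simp
  have "v $ 2 * conic_monomial n m v = (v $ 2)\<^sup>2 * (v $ 1 ^ (n - Suc i) * v $ 3 ^ i)"
    by (simp add: conic_monomial_def i power2_eq_square)
  also have "\<dots> = v $ 1 ^ (n - i) * v $ 3 ^ Suc i - s * (v $ 1 ^ (n - Suc i) * v $ 3 ^ i)"
    unfolding y n by (simp add: algebra_simps)
  finally show ?thesis by (simp add: conic_monomial_def i)
qed

text \<open>
  The relation \<open>y\<^sup>2 = x z - s\<close> reduces every form to the monomials above, up to lower degree. On the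
  conic \<open>(1, t, t\<^sup>2)\<close> these monomials are the powers of \<open>t\<close>, so the coefficients are those of the
  restriction \<open>p\<close> of the form to the conic.
\<close>

lemma conic_normal_form:
  assumes "form n h"
  shows "\<exists>p r. degree p \<le> 2 * n \<and> (\<forall>t. poly p t = h (vector [1, t, t\<^sup>2])) \<and> below n r \<and>
    (\<forall>v. v $ 1 * v $ 3 - (v $ 2)\<^sup>2 = s \<longrightarrow>
       h v = (\<Sum>m\<le>2 * n. coeff p m * conic_monomial n m v) + r v)"
  using assms
proof (induction n arbitrary: h)
  case 0
  then obtain c where "h = (\<lambda>_. c)" by (rule form_0)
  then show ?case by (intro exI[of _ "[:c:]"] exI[of _ "\<lambda>_. 0"]) (simp add: conic_monomial_def)
next
  case (Suc n)
  obtain g where g: "\<And>i. form n (g i)" "h = (\<lambda>v. \<Sum>i\<in>UNIV. v $ i * g i v)"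
    using Suc.prems by (rule form_Suc) blast
  obtain p1 r1 where 1: "degree p1 \<le> 2 * n" "\<And>t. poly p1 t = g 1 (vector [1, t, t\<^sup>2])" "below n r1"
    "\<And>v. v $ 1 * v $ 3 - (v $ 2)\<^sup>2 = s \<Longrightarrow> g 1 v = (\<Sum>m\<le>2 * n. coeff p1 m * conic_monomial n m v) + r1 v"
    using Suc.IH[OF g(1)] by blast
  obtain p2 r2 where 2: "degree p2 \<le> 2 * n" "\<And>t. poly p2 t = g 2 (vector [1, t, t\<^sup>2])" "below n r2"
    "\<And>v. v $ 1 * v $ 3 - (v $ 2)\<^sup>2 = s \<Longrightarrow> g 2 v = (\<Sum>m\<le>2 * n. coeff p2 m * conic_monomial n m v) + r2 v"
    using Suc.IH[OF g(1)] by blast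
  obtain p3 r3 where 3: "degree p3 \<le> 2 * n" "\<And>t. poly p3 t = g 3 (vector [1, t, t\<^sup>2])" "below n r3"
    "\<And>v. v $ 1 * v $ 3 - (v $ 2)\<^sup>2 = s \<Longrightarrow> g 3 v = (\<Sum>m\<le>2 * n. coeff p3 m * conic_monomial n m v) + r3 v"
    using Suc.IH[OF g(1)] by blast
  define p where "p = p1 + pCons 0 p2 + pCons 0 (pCons 0 p3)"
  \<comment> \<open>The correction from \<open>y\<^sup>2 = x z - s\<close>, which occurs when \<open>y\<close> meets a monomial that contains \<open>y\<close>.\<close>
  define e :: "nat \<Rightarrow> real ^ 3 \<Rightarrow> real" where
    "e m v = (if odd m then v $ 1 ^ (n - (m + 1) div 2) * v $ 3 ^ (m div 2) else 0)" for m v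
  define r where "r v = v $ 1 * r1 v + v $ 2 * r2 v + v $ 3 * r3 v +
    (\<Sum>m\<le>2 * n. (- s * coeff p2 m) * e m v)" for v
  have e: "below (Suc n) (e m)" if "m \<le> 2 * n" for m
  proof (cases "odd m")
    case True
    then obtain i where i: "m = 2 * i + 1" by (elim oddE)
    have "form ((n - Suc i) + (i + 0)) (\<lambda>v. v $ 1 ^ (n - Suc i) * (v $ 3 ^ i * 1))"
      by (intro form_coord_power_mult form_const)
    moreover have "e m = (\<lambda>v. v $ 1 ^ (n - Suc i) * (v $ 3 ^ i * 1))"
      by (simp add: e_def i fun_eq_iff)
    ultimately have "form (n - Suc i + (i + 0)) (e m)" by (simp only:)
    then show ?thesis by (rule form_below) (use that i in simp)
  next
    case False
    then have "e m = (\<lambda>_. 0)" by (simp add: e_def fun_eq_iff)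
    then show ?thesis by (simp only: below_zero)
  qed
  have "below (Suc n) r"
    unfolding r_def by (intro below_add below_coord_mult below_sum below_scale 1 2 3 e) auto
  moreover have "degree p \<le> 2 * Suc n"
    unfolding p_def using 1(1) 2(1) 3(1)
    by (intro degree_add_le) (auto simp: degree_pCons_eq_if)
  moreover have "poly p t = h (vector [1, t, t\<^sup>2])" for t
    by (simp add: p_def g(2) sum_3 1(2) 2(2) 3(2) power2_eq_square algebra_simps)
  moreover have "h v = (\<Sum>m\<le>2 * Suc n. coeff p m * conic_monomial (Suc n) m v) + r v"
    if v: "v $ 1 * v $ 3 - (v $ 2)\<^sup>2 = s" for v
  proof -
    let ?E = "conic_monomial (Suc n)"
    \<comment> \<open>Since these coefficients vanish, all sums can be extended to the range \<open>{..2 * Suc n}\<close>.\<close>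
    have c: "coeff p1 (Suc (2 * n)) = 0" "coeff p1 (Suc (Suc (2 * n))) = 0"
       "coeff p2 (Suc (2 * n)) = 0"
      using 1(1) 2(1) by (simp_all add: coeff_eq_0)
    have "v $ 1 * g 1 v = (\<Sum>m\<le>2 * n. coeff p1 m * (v $ 1 * conic_monomial n m v)) + v $ 1 * r1 v"
      by (simp add: 1(4)[OF v] distrib_left sum_distrib_left mult_ac)
    also have "(\<Sum>m\<le>2 * n. coeff p1 m * (v $ 1 * conic_monomial n m v)) = (\<Sum>m\<le>2 * n. coeff p1 m * ?E m v)"
      by (rule sum.cong) (auto simp: conic_monomial_x)
    also have "\<dots> = (\<Sum>m\<le>2 * Suc n. coeff p1 m * ?E m v)"
      by (simp add: c)
    finally have x: "v $ 1 * g 1 v = (\<Sum>m\<le>2 * Suc n. coeff p1 m * ?E m v) + v $ 1 * r1 v" .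
    have "v $ 2 * g 2 v = (\<Sum>m\<le>2 * n. coeff p2 m * (v $ 2 * conic_monomial n m v)) + v $ 2 * r2 v"
      by (simp add: 2(4)[OF v] distrib_left sum_distrib_left mult_ac)
    also have "(\<Sum>m\<le>2 * n. coeff p2 m * (v $ 2 * conic_monomial n m v)) =
        (\<Sum>m\<le>2 * n. coeff p2 m * ?E (Suc m) v + (- s * coeff p2 m) * e m v)"
    proof (rule sum.cong)
      fix m assume "m \<in> {..2 * n}"
      then have eq: "v $ 2 * conic_monomial n m v = ?E (Suc m) v - s * e m v"
        using conic_monomial_y[OF _ v, of m n] unfolding e_def by simp
      show "coeff p2 m * (v $ 2 * conic_monomial n m v) =
          coeff p2 m * ?E (Suc m) v + (- s * coeff p2 m) * e m v"
        unfolding eq by (simp add: algebra_simps)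
    qed simp
    also have "\<dots> = (\<Sum>m\<le>2 * n. coeff p2 m * ?E (Suc m) v) + (\<Sum>m\<le>2 * n. (- s * coeff p2 m) * e m v)"
      by (rule sum.distrib)
    also have "(\<Sum>m\<le>2 * n. coeff p2 m * ?E (Suc m) v) = (\<Sum>m\<le>Suc (2 * n). coeff p2 m * ?E (Suc m) v)"
      by (simp add: c)
    also have "\<dots> = (\<Sum>m\<le>2 * Suc n. coeff (pCons 0 p2) m * ?E m v)"
      by (simp add: sum.atMost_Suc_shift del: sum.atMost_Suc)
    finally have y: "v $ 2 * g 2 v = (\<Sum>m\<le>2 * Suc n. coeff (pCons 0 p2) m * ?E m v)
      + (\<Sum>m\<le>2 * n. (- s * coeff p2 m) * e m v) + v $ 2 * r2 v" .
    have "v $ 3 * g 3 v = (\<Sum>m\<le>2 * n. coeff p3 m * (v $ 3 * conic_monomial n m v)) + v $ 3 * r3 v"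
      by (simp add: 3(4)[OF v] distrib_left sum_distrib_left mult_ac)
    also have "(\<Sum>m\<le>2 * n. coeff p3 m * (v $ 3 * conic_monomial n m v)) = (\<Sum>m\<le>2 * n. coeff p3 m * ?E (Suc (Suc m)) v)"
      by (simp add: conic_monomial_z)
    also have "\<dots> = (\<Sum>m\<le>2 * Suc n. coeff (pCons 0 (pCons 0 p3)) m * ?E m v)"
      by (simp add: sum.atMost_Suc_shift del: sum.atMost_Suc)
    finally have z: "v $ 3 * g 3 v = (\<Sum>m\<le>2 * Suc n. coeff (pCons 0 (pCons 0 p3)) m * ?E m v) + v $ 3 * r3 v" .
    have "(\<Sum>m\<le>2 * Suc n. coeff p m * ?E m v) = (\<Sum>m\<le>2 * Suc n. coeff p1 m * ?E m v) +
       (\<Sum>m\<le>2 * Suc n. coeff (pCons 0 p2) m * ?E m v) + (\<Sum>m\<le>2 * Suc n. coeff (pCons 0 (pCons 0 p3)) m * ?E m v)"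
      unfolding p_def coeff_add distrib_right sum.distrib ..
    then show ?thesis
      unfolding g(2) sum_3 x y z r_def by simp
  qed
  ultimately show ?case by (intro exI[of _ p] exI[of _ r] conjI allI impI)
qed

text \<open>
  A polynomial of degree at most two is the restriction of a linear form to \<open>(1, t, t\<^sup>2)\<close>. Factoring
  the restriction of \<open>h\<close> into such polynomials gives a product of linear forms with the same
  restriction, hence with the same normal form.
\<close>

theorem splits_on_hyperboloid: "splits_on {v. v $ 1 * v $ 3 - (v $ 2)\<^sup>2 = s}"
  unfolding splits_on_def
proof (intro allI impI)
  fix n h assume "form n h"
  then obtain p r where p: "degree p \<le> 2 * n" "\<And>t. poly p t = h (vector [1, t, t\<^sup>2])" "below n r"
    "\<And>v. v $ 1 * v $ 3 - (v $ 2)\<^sup>2 = s \<Longrightarrow> h v = (\<Sum>m\<le>2 * n. coeff p m * conic_monomial n m v) + r v"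
    using conic_normal_form by blast
  obtain c q where q: "\<And>j. degree (q j) \<le> 2" "p = smult c (\<Prod>j\<in>{1..n}. q j)"
    using real_poly_quadratic_factorization[OF p(1)] by blast
  define w :: "nat \<Rightarrow> real ^ 3" where "w j = vector [coeff (q j) 0, coeff (q j) 1, coeff (q j) 2]" for j
  have "form n (\<lambda>v. c * (\<Prod>j\<in>{1..n}. w j \<bullet> v))"
    by (intro form_scale form_linear_prod)
  then obtain p' r' where p': "\<And>t. poly p' t = c * (\<Prod>j\<in>{1..n}. w j \<bullet> vector [1, t, t\<^sup>2])" "below n r'"
    "\<And>v. v $ 1 * v $ 3 - (v $ 2)\<^sup>2 = s \<Longrightarrow> c * (\<Prod>j\<in>{1..n}. w j \<bullet> v) =
      (\<Sum>m\<le>2 * n. coeff p' m * conic_monomial n m v) + r' v"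
    using conic_normal_form by blast
  have w: "w j \<bullet> vector [1, t, t\<^sup>2] = poly (q j) t" for j t
  proof -
    have "q j = [:coeff (q j) 0, coeff (q j) 1, coeff (q j) 2:]"
      using q(1)[of j]
      by (intro poly_eqI) (auto simp: coeff_pCons coeff_eq_0 numeral_2_eq_2 split: nat.splits)
    then have "poly (q j) t = poly [:coeff (q j) 0, coeff (q j) 1, coeff (q j) 2:] t" by (rule arg_cong)
    then show ?thesis
      by (simp add: w_def inner_vec_def sum_3 power2_eq_square algebra_simps)
  qed
  have "poly p' t = poly p t" for t
    by (simp add: p'(1) w q(2) poly_prod)
  then have "p' = p" by (rule poly_ext)
  then have "h v = c * (\<Prod>j\<in>{1..n}. w j \<bullet> v) + (r v - r' v)" if "v $ 1 * v $ 3 - (v $ 2)\<^sup>2 = s" for v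
    using p(4)[OF that] p'(3)[OF that] by simp
  then show "\<exists>c w r. below n r \<and> (\<forall>v\<in>{v. v $ 1 * v $ 3 - (v $ 2)\<^sup>2 = s}. h v = c * (\<Prod>j\<in>{1..n}. w j \<bullet> v) + r v)"
    using below_diff[OF p(3) p'(2)]
    by (intro exI[of _ c] exI[of _ w] exI[of _ "\<lambda>v. r v - r' v"]) simp
qed

section \<open>Non-degenerate quadrics\<close>

definition frame_map :: "real ^ 3 \<Rightarrow> real ^ 3 \<Rightarrow> real ^ 3 \<Rightarrow> real ^ 3 \<Rightarrow> real ^ 3" where
  "frame_map a b c v = (v $ 1) *\<^sub>R a + (v $ 2) *\<^sub>R b + (v $ 3) *\<^sub>R c"

lemma linear_frame_map: "linear (frame_map a b c)"
  by (rule linearI) (simp_all add: frame_map_def algebra_simps)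

lemma splits_on_frame:
  assumes "inj (frame_map a b c)" "splits_on {v. q (frame_map a b c v)}"
  shows "splits_on {v. q v}"
proof -
  have "surj (frame_map a b c)"
    by (rule linear_inj_imp_surj[OF linear_frame_map assms(1)])
  then have "{v. q v} = frame_map a b c ` {v. q (frame_map a b c v)}"
    by auto
  then show ?thesis using splits_on_image[OF linear_frame_map assms] by simp
qed

text \<open>
  A real quadratic form is treated as \<open>v \<mapsto> v \<bullet> N v\<close>; its polar form is \<open>u \<bullet> N v\<close>.
\<close>

locale self_adjoint_map =
  fixes N :: "real ^ 3 \<Rightarrow> real ^ 3"
  assumes linear: "linear N" and symmetric: "\<And>u v. u \<bullet> N v = v \<bullet> N u"
begin

lemmas map_simps = linear_add[OF linear] linear_scale[OF linear] linear_diff[OF linear] linear_0[OF linear] linear_neg[OF linear]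

lemma quadratic_frame:
  "frame_map a b c v \<bullet> N (frame_map a b c v) =
     (v $ 1)\<^sup>2 * (a \<bullet> N a) + (v $ 2)\<^sup>2 * (b \<bullet> N b) + (v $ 3)\<^sup>2 * (c \<bullet> N c) +
     2 * (v $ 1 * v $ 2 * (a \<bullet> N b) + v $ 1 * v $ 3 * (a \<bullet> N c) + v $ 2 * v $ 3 * (b \<bullet> N c))"
  using symmetric[of b a] symmetric[of c a] symmetric[of c b]
  by (simp add: frame_map_def map_simps inner_add_left inner_add_right power2_eq_square algebra_simps)

text \<open>
  Complete \<open>a\<close> to a hyperbolic pair \<open>a\<close>, \<open>b\<close> and add a vector \<open>n\<close> orthogonal to both for the polar form.
  In this basis the quadratic form is \<open>2 x z + (n \<bullet> N n) y\<^sup>2\<close>, and rescaling \<open>b\<close> makes it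
  proportional to \<open>x z - y\<^sup>2\<close>.
\<close>

lemma splits_on_isotropic:
  assumes kernel: "\<And>v. N v = 0 \<Longrightarrow> v = 0" and a: "a \<noteq> 0" "a \<bullet> N a = 0"
  shows "splits_on {v. v \<bullet> N v = 1}"
proof -
  have Na: "N a \<noteq> 0" using kernel a(1) by blast
  define b0 where "b0 = N a /\<^sub>R (N a \<bullet> N a)"
  \<comment> \<open>Subtracting this multiple of \<open>a\<close> makes \<open>b\<close> isotropic and keeps \<open>a \<bullet> N b = 1\<close>.\<close>
  define b where "b = b0 - ((b0 \<bullet> N b0) / 2) *\<^sub>R a"
  have b0: "a \<bullet> N b0 = 1" "b0 \<bullet> N a = 1" using Na symmetric[of a b0] by (simp_all add: b0_def)
  have b: "a \<bullet> N b = 1" "b \<bullet> N a = 1" "b \<bullet> N b = 0"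
    using b0 a(2) by (simp_all add: b_def map_simps inner_diff_left inner_diff_right)
  define n where "n = N a \<times> N b"
  have n: "a \<bullet> N n = 0" "n \<bullet> N a = 0" "b \<bullet> N n = 0" "n \<bullet> N b = 0"
    using symmetric[of a n] symmetric[of b n] by (simp_all add: n_def dot_cross_self)
  have n0: "n \<noteq> 0"
  proof
    assume "n = 0"
    moreover have "(N a \<times> N b) \<times> a = (N a \<bullet> a) *\<^sub>R N b - (N b \<bullet> a) *\<^sub>R N a"
      by (simp add: cross3_simps forall_3)
    ultimately have "(N b \<bullet> a) *\<^sub>R N a = 0"
      using a(2) by (simp add: n_def inner_commute)
    then show False using b(1) Na by (simp add: inner_commute)
  qed
  have inj: "inj (frame_map a n (s *\<^sub>R b))" if "s \<noteq> 0" for s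
    unfolding linear_injective_0[OF linear_frame_map]
  proof (intro allI impI)
    fix v assume v: "frame_map a n (s *\<^sub>R b) v = 0"
    have "frame_map a n (s *\<^sub>R b) v \<bullet> N a = v $ 3 * s" "frame_map a n (s *\<^sub>R b) v \<bullet> N b = v $ 1"
      using a(2) b n by (simp_all add: frame_map_def inner_add_left)
    then have "v $ 3 = 0" "v $ 1 = 0" using that v by simp_all
    then have "v $ 2 = 0" using v n0 by (simp add: frame_map_def)
    then show "v = 0" using \<open>v $ 3 = 0\<close> \<open>v $ 1 = 0\<close> by (simp add: vec_eq_iff forall_3)
  qed
  \<comment> \<open>Otherwise \<open>N n\<close> is orthogonal to \<open>a\<close>, \<open>b\<close>, \<open>n\<close>, hence zero.\<close>
  have nn: "n \<bullet> N n \<noteq> 0"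
  proof
    assume nn: "n \<bullet> N n = 0"
    have "surj (frame_map a n (1 *\<^sub>R b))"
      by (rule linear_inj_imp_surj[OF linear_frame_map inj]) simp
    then obtain x where "N n = frame_map a n (1 *\<^sub>R b) x" by (metis surjD)
    then have "N n \<bullet> N n = 0"
      using n nn by (simp add: frame_map_def inner_add_left) 
    then show False using kernel n0 by simp
  qed
  show ?thesis
  proof (rule splits_on_frame)
    show "inj (frame_map a n ((- (n \<bullet> N n) / 2) *\<^sub>R b))" using nn by (intro inj) simp
    have "(frame_map a n ((- (n \<bullet> N n) / 2) *\<^sub>R b) v \<bullet> N (frame_map a n ((- (n \<bullet> N n) / 2) *\<^sub>R b) v) = 1)
        \<longleftrightarrow> v $ 1 * v $ 3 - (v $ 2)\<^sup>2 = - 1 / (n \<bullet> N n)" for v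
      unfolding quadratic_frame using a(2) b n nn by (auto simp: map_simps field_simps)
    then show "splits_on {v. frame_map a n ((- (n \<bullet> N n) / 2) *\<^sub>R b) v \<bullet>
        N (frame_map a n ((- (n \<bullet> N n) / 2) *\<^sub>R b) v) = 1}"
      using splits_on_hyperboloid by simp
  qed
qed

text \<open>
  Otherwise the quadratic form would vanish somewhere on the segment from \<open>v\<close> to \<open>u\<close>.
\<close>

lemma anisotropic_positive:
  assumes an: "\<And>v. v \<bullet> N v = 0 \<Longrightarrow> v = 0" and u: "u \<bullet> N u > 0" and v: "v \<noteq> 0"
  shows "v \<bullet> N v > 0"
proof (rule ccontr)
  assume "\<not> v \<bullet> N v > 0"
  then have v0: "v \<bullet> N v < 0" using an[of v] v by fastforce
  define x where "x t = (1 - t) *\<^sub>R v + t *\<^sub>R u" for t :: real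
  define q where "q t = x t \<bullet> N (x t)" for t
  have "q t = (1 - t)\<^sup>2 * (v \<bullet> N v) + 2 * (t * (1 - t) * (u \<bullet> N v)) + t\<^sup>2 * (u \<bullet> N u)" for t
    using symmetric[of v u]
    by (simp add: q_def x_def map_simps inner_add_left inner_add_right power2_eq_square algebra_simps)
  then have "continuous_on {0..1} q" 
    by (simp add: continuous_intros cong: continuous_on_cong)
  then obtain t where t: "0 \<le> t" "t \<le> 1" "q t = 0"
    using IVT'[of q 0 0 1] v0 u by (auto simp: q_def x_def)
  then have "x t = 0" using an by (simp add: q_def)
  then have eq: "(1 - t) *\<^sub>R v = (- t) *\<^sub>R u" by (simp add: x_def add_eq_0_iff)
  have "((1 - t) *\<^sub>R v) \<bullet> N ((1 - t) *\<^sub>R v) = (1 - t)\<^sup>2 * (v \<bullet> N v)"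
    by (simp add: map_simps power2_eq_square)
  moreover have "((1 - t) *\<^sub>R v) \<bullet> N ((1 - t) *\<^sub>R v) = t\<^sup>2 * (u \<bullet> N u)"
    unfolding eq by (simp add: map_simps power2_eq_square)
  ultimately have e: "(1 - t)\<^sup>2 * (v \<bullet> N v) = t\<^sup>2 * (u \<bullet> N u)" by simp
  have "(1 - t)\<^sup>2 * (v \<bullet> N v) \<le> 0" "t\<^sup>2 * (u \<bullet> N u) \<ge> 0"
    using v0 u by (simp_all add: mult_nonneg_nonpos)
  then have "(1 - t)\<^sup>2 * (v \<bullet> N v) = 0" "t\<^sup>2 * (u \<bullet> N u) = 0" using e by linarith+
  then show False using v0 u by simp
qed

text \<open>
  Orthonormalization for the polar form, with the cross product supplying the third vector.
\<close>

lemma splits_on_positive: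
  assumes pos: "\<And>v. v \<noteq> 0 \<Longrightarrow> v \<bullet> N v > 0"
  shows "splits_on {v. v \<bullet> N v = 1}"
proof -
  define unit where "unit v = v /\<^sub>R sqrt (v \<bullet> N v)" for v
  have unit: "unit v \<bullet> N (unit v) = 1" if "v \<noteq> 0" for v
    using pos[OF that] by (simp add: unit_def map_simps field_simps)
  obtain w1 :: "real ^ 3" where w1: "w1 \<noteq> 0" by (metis zero_neq_one)
  define b1 where "b1 = unit w1"
  have b1: "b1 \<bullet> N b1 = 1" using unit w1 by (simp add: b1_def)
  obtain w2 where w2: "w2 \<noteq> 0" "orthogonal (N b1) w2"
    using orthogonal_to_vector_exists[of "N b1"] by auto
  define b2 where "b2 = unit w2"
  have b2: "b2 \<bullet> N b2 = 1" "b2 \<bullet> N b1 = 0" "b1 \<bullet> N b2 = 0"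
    using unit w2 symmetric[of b1 b2] by (simp_all add: b2_def unit_def orthogonal_def inner_commute)
  define w3 where "w3 = N b1 \<times> N b2"
  have w3: "w3 \<noteq> 0"
  proof
    assume "w3 = 0"
    moreover have "(N b1 \<times> N b2) \<times> b1 = (N b1 \<bullet> b1) *\<^sub>R N b2 - (N b2 \<bullet> b1) *\<^sub>R N b1"
      by (simp add: cross3_simps forall_3)
    ultimately have "N b2 = 0" using b1 b2(3) by (simp add: w3_def inner_commute)
    then show False using b2(1) by simp
  qed
  define b3 where "b3 = unit w3"
  have b3: "b3 \<bullet> N b3 = 1" "b1 \<bullet> N b3 = 0" "b2 \<bullet> N b3 = 0"
    using unit w3 symmetric[of b1 b3] symmetric[of b2 b3]
    by (simp_all add: b3_def unit_def w3_def dot_cross_self)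
  have q: "frame_map b1 b2 b3 v \<bullet> N (frame_map b1 b2 b3 v) = v \<bullet> v" for v
  proof -
    have "v \<bullet> v = (v $ 1)\<^sup>2 + (v $ 2)\<^sup>2 + (v $ 3)\<^sup>2"
      by (simp add: inner_vec_def sum_3 power2_eq_square)
    then show ?thesis unfolding quadratic_frame by (simp add: b1 b2 b3)
  qed
  show ?thesis
  proof (rule splits_on_frame)
    show "inj (frame_map b1 b2 b3)"
      unfolding linear_injective_0[OF linear_frame_map]
      using q by (metis inner_eq_zero_iff inner_zero_left)
    have "{v. frame_map b1 b2 b3 v \<bullet> N (frame_map b1 b2 b3 v) = 1} = sphere 0 1"
      by (auto simp: q norm_eq_1)
    then show "splits_on {v. frame_map b1 b2 b3 v \<bullet> N (frame_map b1 b2 b3 v) = 1}"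
      using splits_on_sphere by simp
  qed
qed

theorem splits_on_nondegenerate_quadric:
  assumes "\<And>v. N v = 0 \<Longrightarrow> v = 0"
  shows "splits_on {v. v \<bullet> N v = 1}"
proof (cases "\<exists>a. a \<noteq> 0 \<and> a \<bullet> N a = 0")
  case True
  then show ?thesis using splits_on_isotropic assms by blast
next
  case False
  show ?thesis
  proof (cases "\<exists>u. u \<bullet> N u = 1")
    case True
    then obtain u where "u \<bullet> N u > 0" by (metis zero_less_one)
    then show ?thesis using False anisotropic_positive by (intro splits_on_positive) blast
  next
    case False
    then have empty: "{v. v \<bullet> N v = 1} = {}" by blast
    show ?thesis unfolding splits_on_def empty using below_zero by blast
  qed
qed

end

text \<open>
  A quadratic form with a kernel vector \<open>n\<close> only depends on the component orthogonal to \<open>n\<close>. It is a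
  binary form, and binary quadratic forms split over the complex numbers.
\<close>

lemma symmetric_kernel_factorization:
  assumes "self_adjoint_map N" "N n = 0" "n \<noteq> 0"
  obtains p q :: "complex ^ 3"
  where "\<And>v. complex_of_real (v \<bullet> N v) = (\<Sum>i\<in>UNIV. of_real (v $ i) * p $ i) * (\<Sum>i\<in>UNIV. of_real (v $ i) * q $ i)"
proof -
  interpret self_adjoint_map N by fact
  obtain w where w: "w \<noteq> 0" "orthogonal n w"
    using orthogonal_to_vector_exists[of n] by auto
  define m where "m = n /\<^sub>R norm n"
  define e where "e = w /\<^sub>R norm w"
  have me: "norm m = 1" "norm e = 1" "m \<bullet> e = 0"
    using assms(3) w by (simp_all add: m_def e_def orthogonal_def)
  define f where "f = m \<times> e"
  have Nm: "N m = 0" using assms(2) by (simp add: m_def map_simps)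
  define \<alpha> \<beta> \<gamma> where "\<alpha> = e \<bullet> N e" and "\<beta> = e \<bullet> N f" and "\<gamma> = f \<bullet> N f"
  have Q: "v \<bullet> N v = \<alpha> * (e \<bullet> v)\<^sup>2 + 2 * \<beta> * (e \<bullet> v) * (f \<bullet> v) + \<gamma> * (f \<bullet> v)\<^sup>2" for v
  proof -
    have "v = frame_map m e f (vector [m \<bullet> v, e \<bullet> v, f \<bullet> v])"
      using orthonormal_expansion[OF me, of v] by (simp add: frame_map_def f_def)
    then have "v \<bullet> N v = frame_map m e f (vector [m \<bullet> v, e \<bullet> v, f \<bullet> v]) \<bullet> N (frame_map m e f (vector [m \<bullet> v, e \<bullet> v, f \<bullet> v]))"
      by simp
    also have "\<dots> = \<alpha> * (e \<bullet> v)\<^sup>2 + 2 * \<beta> * (e \<bullet> v) * (f \<bullet> v) + \<gamma> * (f \<bullet> v)\<^sup>2"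
      unfolding quadratic_frame using symmetric[of m e] symmetric[of m f]
      by (simp add: Nm \<alpha>_def \<beta>_def \<gamma>_def)
    finally show ?thesis .
  qed
  have lin: "(\<Sum>i\<in>UNIV. of_real (v $ i) * (\<chi> i. x * of_real (e $ i) + y * of_real (f $ i)) $ i)
      = x * of_real (e \<bullet> v) + y * of_real (f \<bullet> v)" for x y :: complex and v
    by (simp add: inner_vec_def sum_distrib_left sum.distrib algebra_simps)
  define X Y where "X v = (of_real (e \<bullet> v) :: complex)" and "Y v = (of_real (f \<bullet> v) :: complex)" for v
  have QC: "of_real (v \<bullet> N v) = of_real \<alpha> * (X v)\<^sup>2 + 2 * of_real \<beta> * X v * Y v + of_real \<gamma> * (Y v)\<^sup>2" for v
    by (simp add: Q X_def Y_def)
  show thesis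
  proof (cases "\<alpha> = 0")
    case True
    show thesis
    proof (rule that)
      fix v
      show "complex_of_real (v \<bullet> N v) =
         (\<Sum>i\<in>UNIV. of_real (v $ i) * (\<chi> i. 0 * of_real (e $ i) + 1 * of_real (f $ i)) $ i) *
         (\<Sum>i\<in>UNIV. of_real (v $ i) * (\<chi> i. 2 * of_real \<beta> * of_real (e $ i) + of_real \<gamma> * of_real (f $ i)) $ i)"
        unfolding lin QC X_def[symmetric] Y_def[symmetric] True
        by (simp add: power2_eq_square algebra_simps)
    qed
  next
    case False
    \<comment> \<open>The factors come from completing the square.\<close>
    define s where "s = csqrt (of_real (\<beta>\<^sup>2 - \<alpha> * \<gamma>))"
    have s: "s * s = of_real \<beta> * of_real \<beta> - of_real \<alpha> * of_real \<gamma>"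
      using power2_csqrt[of "of_real (\<beta>\<^sup>2 - \<alpha> * \<gamma>)"] by (simp add: s_def power2_eq_square)
    show thesis
    proof (rule that)
      fix v
      have "(of_real \<alpha> * X v + (of_real \<beta> + s) * Y v) * (of_real \<alpha> * X v + (of_real \<beta> - s) * Y v)
        = of_real \<alpha> * of_real \<alpha> * (X v * X v) + 2 * of_real \<alpha> * of_real \<beta> * (X v * Y v)
          + (of_real \<beta> * of_real \<beta> - s * s) * (Y v * Y v)"
        by (simp add: algebra_simps)
      also have "\<dots> = of_real \<alpha> * of_real (v \<bullet> N v)"
        unfolding s QC by (simp add: power2_eq_square algebra_simps)
      finally have "complex_of_real (v \<bullet> N v) = (1 * X v + ((of_real \<beta> + s) / of_real \<alpha>) * Y v) * (of_real \<alpha> * X v + (of_real \<beta> - s) * Y v)"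
        using False by (simp add: field_simps)
      then show "complex_of_real (v \<bullet> N v) =
         (\<Sum>i\<in>UNIV. of_real (v $ i) * (\<chi> i. 1 * of_real (e $ i) + ((of_real \<beta> + s) / of_real \<alpha>) * of_real (f $ i)) $ i) *
         (\<Sum>i\<in>UNIV. of_real (v $ i) * (\<chi> i. of_real \<alpha> * of_real (e $ i) + (of_real \<beta> - s) * of_real (f $ i)) $ i)"
        unfolding lin X_def Y_def .
    qed
  qed
qed

unbundle no cross3_syntax
unbundle set_product_syntax

section \<open>Irreducible quadratic forms are non-degenerate\<close>

lemma form_monomial: "form (\<Sum>i\<in>A. k i) (\<lambda>v. \<Prod>i\<in>A. v $ i ^ k i)"
proof (induction A rule: infinite_finite_induct)
  case (insert i A)
  then show ?case using form_coord_power_mult[OF insert.IH, of "k i" i] by simp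
qed (simp_all add: form_const)

lemma eval3_below: "below (Suc (total_degree P)) (eval3 P)"
proof -
  have "below (Suc (total_degree P))
      (\<lambda>v. \<Sum>m\<in>Poly_Mapping.keys P. Poly_Mapping.lookup P m * (\<Prod>i\<in>UNIV. (v $ i) ^ Poly_Mapping.lookup m i))"
  proof (intro below_sum below_scale form_below)
    fix m assume "m \<in> Poly_Mapping.keys P"
    then show "monomial_degree m < Suc (total_degree P)"
      unfolding total_degree_def less_Suc_eq_le by (intro Max_ge) auto
    show "form (monomial_degree m) (\<lambda>v. \<Prod>i\<in>UNIV. (v $ i) ^ Poly_Mapping.lookup m i)"
      unfolding monomial_degree_def by (rule form_monomial)
  qed
  then show ?thesis by (simp add: eval3_def[abs_def])
qed

lemma eval3_superset:
  assumes "finite S" "Poly_Mapping.keys p \<subseteq> S"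
  shows "eval3 p v = (\<Sum>m\<in>S. Poly_Mapping.lookup p m * (\<Prod>i\<in>UNIV. (v $ i) ^ Poly_Mapping.lookup m i))"
  unfolding eval3_def using assms by (intro sum.mono_neutral_left) (auto simp: in_keys_iff)

lemma eval3_add: "eval3 (p + q) v = eval3 p v + eval3 q v"
proof -
  let ?S = "Poly_Mapping.keys p \<union> Poly_Mapping.keys q"
  have "Poly_Mapping.keys (p + q) \<subseteq> ?S" by (rule Poly_Mapping.keys_add)
  then show ?thesis
    by (simp add: eval3_superset[of ?S] lookup_add distrib_right sum.distrib)
qed

lemma eval3_zero: "eval3 0 v = 0"
  by (simp add: eval3_def)

lemma eval3_sum: "eval3 (\<Sum>i\<in>A. f i) v = (\<Sum>i\<in>A. eval3 (f i) v)"
  by (induction A rule: infinite_finite_induct) (simp_all add: eval3_zero eval3_add)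

lemma eval3_single:
  "eval3 (Poly_Mapping.single m c) v = c * (\<Prod>i\<in>UNIV. (v $ i) ^ Poly_Mapping.lookup m i)"
  by (subst eval3_superset[of "{m}"]) auto

text \<open>
  The exponent of a single variable, written with \<open>Suc 0\<close> because this is the form to which
  simplification rewrites it.
\<close>

abbreviation variable :: "3 \<Rightarrow> (3 \<Rightarrow>\<^sub>0 nat)" where
  "variable i \<equiv> Poly_Mapping.single i (Suc 0)"

definition quadratic_poly :: "(3 \<Rightarrow> 3 \<Rightarrow> 'a) \<Rightarrow> 'a::comm_ring_1 poly3" where
  "quadratic_poly A = (\<Sum>i\<in>UNIV. \<Sum>j\<in>UNIV. Poly_Mapping.single (variable i + variable j) (A i j))"

definition linear_poly :: "(3 \<Rightarrow> 'a) \<Rightarrow> 'a::comm_ring_1 poly3" where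
  "linear_poly p = (\<Sum>i\<in>UNIV. Poly_Mapping.single (variable i) (p i))"

lemma linear_poly_mult: "linear_poly p * linear_poly q = quadratic_poly (\<lambda>i j. p i * q j)"
  by (simp add: linear_poly_def quadratic_poly_def sum_product mult_single)

lemma eval3_quadratic_poly: "eval3 (quadratic_poly A) v = (\<Sum>i\<in>UNIV. \<Sum>j\<in>UNIV. A i j * (v $ i * v $ j))"
proof -
  have "(\<Prod>k\<in>UNIV. (v $ k) ^ Poly_Mapping.lookup (variable i + variable j) k) = v $ i * v $ j" for i j
  proof -
    have "(\<Prod>k\<in>UNIV. (v $ k) ^ Poly_Mapping.lookup (variable i + variable j) k) =
      (\<Prod>k\<in>UNIV. (if k = i then v $ k else 1)) * (\<Prod>k\<in>UNIV. (if k = j then v $ k else 1))"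
      unfolding prod.distrib[symmetric]
      by (intro prod.cong) (auto simp: lookup_add lookup_single when_def power_add)
    then show ?thesis by (simp add: prod.delta)
  qed
  then show ?thesis
    by (simp add: quadratic_poly_def eval3_sum eval3_single)
qed

lemma variable_add_eq_iff:
  "variable i + variable j = variable a + variable b \<longleftrightarrow> (i = a \<and> j = b) \<or> (i = b \<and> j = a)"
proof
  assume "variable i + variable j = variable a + variable b"
  then have "Poly_Mapping.lookup (variable i + variable j) k = Poly_Mapping.lookup (variable a + variable b) k" for k
    by simp
  then have *: "(if i = k then Suc 0 else 0) + (if j = k then Suc 0 else 0) = (if a = k then Suc 0 else 0) + (if b = k then Suc 0 else 0)" for k
    unfolding lookup_add lookup_single when_def .
  show "(i = a \<and> j = b) \<or> (i = b \<and> j = a)"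
    using *[of i] *[of j] *[of a] *[of b] by (auto split: if_splits)
qed (auto simp: add.commute)

lemma nat_sum_eq_2_cases:
  fixes a b c :: nat
  assumes "a + b + c = 2"
  shows "a = 2 \<and> b = 0 \<and> c = 0 \<or> a = 0 \<and> b = 2 \<and> c = 0 \<or> a = 0 \<and> b = 0 \<and> c = 2 \<or>
    a = 1 \<and> b = 1 \<and> c = 0 \<or> a = 1 \<and> b = 0 \<and> c = 1 \<or> a = 0 \<and> b = 1 \<and> c = 1"
  using assms by presburger

lemma monomial_degree_2_cases:
  assumes "monomial_degree m = 2"
  obtains i j where "m = variable i + variable j"
proof -
  let ?l = "Poly_Mapping.lookup m"
  have s: "?l 1 + ?l 2 + ?l 3 = 2" using assms by (simp add: monomial_degree_def sum_3)
  have eq: "m = variable i + variable j" if "\<forall>k. ?l k = (if i = k then 1 else 0) + (if j = k then 1 else 0)" for i j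
    using that by (intro poly_mapping_eqI) (simp add: lookup_add lookup_single when_def)
  consider "?l 1 = 2" "?l 2 = 0" "?l 3 = 0" | "?l 1 = 0" "?l 2 = 2" "?l 3 = 0" | "?l 1 = 0" "?l 2 = 0" "?l 3 = 2"
    | "?l 1 = 1" "?l 2 = 1" "?l 3 = 0" | "?l 1 = 1" "?l 2 = 0" "?l 3 = 1" | "?l 1 = 0" "?l 2 = 1" "?l 3 = 1"
    using nat_sum_eq_2_cases[OF s] by (elim disjE conjE) simp_all
  then show thesis
  proof cases
    case 1 show thesis by (rule that[of 1 1], rule eq) (simp add: 1 forall_3)
  next
    case 2 show thesis by (rule that[of 2 2], rule eq) (simp add: 2 forall_3)
  next
    case 3 show thesis by (rule that[of 3 3], rule eq) (simp add: 3 forall_3)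
  next
    case 4 show thesis by (rule that[of 1 2], rule eq) (simp add: 4 forall_3)
  next
    case 5 show thesis by (rule that[of 1 3], rule eq) (simp add: 5 forall_3)
  next
    case 6 show thesis by (rule that[of 2 3], rule eq) (simp add: 6 forall_3)
  qed
qed

lemma monomial_degree_variables: "monomial_degree (variable i + variable j) = 2"
  by (simp add: monomial_degree_def lookup_add sum.distrib lookup_single when_def)

lemma lookup_quadratic_poly:
  "Poly_Mapping.lookup (quadratic_poly A) m =
     (\<Sum>i\<in>UNIV. \<Sum>j\<in>UNIV. A i j when variable i + variable j = m)"
  by (simp add: quadratic_poly_def lookup_sum lookup_single)

lemma lookup_quadratic_poly_other:
  "monomial_degree m \<noteq> 2 \<Longrightarrow> Poly_Mapping.lookup (quadratic_poly A) m = 0"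
  using monomial_degree_variables by (auto simp: lookup_quadratic_poly when_def intro!: sum.neutral)

lemma lookup_quadratic_poly_variables:
  "Poly_Mapping.lookup (quadratic_poly A) (variable a + variable b) =
     (if a = b then A a a else A a b + A b a)"
proof -
  have "Poly_Mapping.lookup (quadratic_poly A) (variable a + variable b) =
     (\<Sum>(i, j)\<in>UNIV \<times> UNIV. A i j when (i, j) \<in> {(a, b), (b, a)})"
    unfolding lookup_quadratic_poly sum.cartesian_product variable_add_eq_iff by simp
  also have "\<dots> = (\<Sum>(i, j)\<in>{(a, b), (b, a)}. A i j)"
    by (intro sum.mono_neutral_cong_right) auto
  finally show ?thesis by simp
qed

text \<open>
  Only the symmetrized coefficients are visible in the polynomial, since variables commute.
\<close>

lemma quadratic_poly_eqI:
  fixes A B :: "3 \<Rightarrow> 3 \<Rightarrow> 'a::field_char_0"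
  assumes "\<And>i j. A i j + A j i = B i j + B j i"
  shows "quadratic_poly A = quadratic_poly B"
proof (rule poly_mapping_eqI)
  fix m
  have "A i i = B i i" for i
    using assms[of i i] by (simp flip: mult_2)
  then show "Poly_Mapping.lookup (quadratic_poly A) m = Poly_Mapping.lookup (quadratic_poly B) m"
    using assms
    by (cases "monomial_degree m = 2")
       (auto simp: lookup_quadratic_poly_other lookup_quadratic_poly_variables elim!: monomial_degree_2_cases)
qed

lemma quadratic_form_symmetric_coefficients:
  fixes q :: "real poly3"
  assumes "quadratic_form q"
  obtains A where "\<And>i j. A i j = A j i" "q = quadratic_poly A"
proof (rule that)
  let ?A = "\<lambda>i j. Poly_Mapping.lookup q (variable i + variable j) / (if i = j then 1 else 2)"
  show "?A i j = ?A j i" for i j by (simp add: add.commute)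
  show "q = quadratic_poly ?A"
  proof (rule poly_mapping_eqI)
    fix m
    show "Poly_Mapping.lookup q m = Poly_Mapping.lookup (quadratic_poly ?A) m"
    proof (cases "monomial_degree m = 2")
      case True
      then obtain i j where "m = variable i + variable j" by (rule monomial_degree_2_cases)
      then show ?thesis by (simp add: lookup_quadratic_poly_variables add.commute)
    next
      case False
      then show ?thesis using assms
        by (auto simp: lookup_quadratic_poly_other quadratic_form_def in_keys_iff)
    qed
  qed
qed

lemma complexify_quadratic_poly:
  "complexify (quadratic_poly A) = quadratic_poly (\<lambda>i j. of_real (A i j))"
proof (rule poly_mapping_eqI)
  fix m
  have "Poly_Mapping.lookup (complexify p) m = of_real (Poly_Mapping.lookup p m)" for p
    by (simp add: complexify_def Poly_Mapping.map.rep_eq when_def)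
  then show "Poly_Mapping.lookup (complexify (quadratic_poly A)) m =
      Poly_Mapping.lookup (quadratic_poly (\<lambda>i j. of_real (A i j))) m"
    by (auto simp: lookup_quadratic_poly when_def intro!: sum.cong)
qed

text \<open>
  A multiple of a polynomial without constant term has no constant term.
\<close>

lemma linear_poly_not_unit: "\<not> linear_poly (p :: 3 \<Rightarrow> 'a::comm_ring_1) dvd 1"
proof
  assume "linear_poly p dvd 1"
  then obtain r where r: "1 = linear_poly p * r" by (elim dvdE)
  have zero: "(0 = l + k) = (l = 0 \<and> k = 0)" for l k :: "3 \<Rightarrow>\<^sub>0 nat"
    by (auto simp: poly_mapping_eq_iff fun_eq_iff lookup_add)
  have "Poly_Mapping.lookup (linear_poly p) 0 = 0"
  proof -
    have "variable i \<noteq> 0" for i by (metis lookup_single_eq lookup_zero nat.distinct(1))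
    then show ?thesis by (simp add: linear_poly_def lookup_sum lookup_single when_def)
  qed
  then have "Poly_Mapping.lookup (linear_poly p * r) 0 = 0"
  proof -
    have f0: "(\<lambda>l. Poly_Mapping.lookup (linear_poly p) l *
        (\<Sum>k. Poly_Mapping.lookup r k when 0 = l + k)) = (\<lambda>_. 0)"
    proof
      fix l
      show "Poly_Mapping.lookup (linear_poly p) l * (\<Sum>k. Poly_Mapping.lookup r k when 0 = l + k) = 0"
        using \<open>Poly_Mapping.lookup (linear_poly p) 0 = 0\<close> by (cases "l = 0") (simp_all add: zero)
    qed
    show ?thesis unfolding lookup_mult f0 by simp
  qed
  then show False unfolding r[symmetric] by (simp add: lookup_one)
qed

text \<open>
  A kernel vector would make the quadratic form a product of two complex linear functions of \<open>v\<close>.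
  Polarization turns this into an identity between coefficients, that is, into a factorization of the
  polynomial.
\<close>

theorem irreducible_quadratic_form_nondegenerate:
  fixes Q :: "real poly3"
  assumes "quadratic_form Q" "irreducible (complexify Q)"
  obtains N where "self_adjoint_map N" "\<And>v. eval3 Q v = v \<bullet> N v" "\<And>v. N v = 0 \<Longrightarrow> v = 0"
proof -
  obtain A where A: "\<And>i j. A i j = A j i" "Q = quadratic_poly A"
    using quadratic_form_symmetric_coefficients[OF assms(1)] by blast
  define N :: "real ^ 3 \<Rightarrow> real ^ 3" where "N v = (\<chi> i. \<Sum>j\<in>UNIV. A i j * v $ j)" for v
  have N: "u \<bullet> N v = (\<Sum>i\<in>UNIV. \<Sum>j\<in>UNIV. A i j * (u $ i * v $ j))" for u v
    by (simp add: N_def inner_vec_def sum_distrib_left mult_ac)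
  have "linear N"
    by (rule linearI) (simp_all add: N_def vec_eq_iff distrib_left sum.distrib sum_distrib_left mult_ac)
  moreover have "u \<bullet> N v = v \<bullet> N u" for u v
    unfolding N by (subst sum.swap) (simp add: A(1) mult_ac)
  ultimately have sa: "self_adjoint_map N" by (rule self_adjoint_map.intro)
  then interpret self_adjoint_map N .
  show thesis
  proof (rule that[OF sa])
    show "eval3 Q v = v \<bullet> N v" for v by (simp add: A(2) eval3_quadratic_poly N)
    show "n = 0" if Nn: "N n = 0" for n
    proof (rule ccontr)
      assume "n \<noteq> 0"
      then obtain p q where pq: "\<And>v. complex_of_real (v \<bullet> N v) =
          (\<Sum>i\<in>UNIV. of_real (v $ i) * p $ i) * (\<Sum>i\<in>UNIV. of_real (v $ i) * q $ i)"
        by (rule symmetric_kernel_factorization[OF sa Nn]) (rule that)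
      have ax: "axis i 1 \<bullet> N (axis j 1) = A i j" for i j
      proof -
        have "axis i 1 \<bullet> N (axis j 1) = (\<Sum>k\<in>UNIV. A i k * axis j 1 $ k)"
          by (simp add: inner_axis' N_def)
        also have "\<dots> = (\<Sum>k\<in>UNIV. if k = j then A i k else 0)"
          by (intro sum.cong) (auto simp: axis_def)
        finally show ?thesis by simp
      qed
      have sel: "(\<Sum>k\<in>UNIV. of_real (axis i 1 $ k) * r $ k) = r $ i" for i :: 3 and r :: "complex ^ 3"
      proof -
        have "(\<Sum>k\<in>UNIV. of_real (axis i 1 $ k) * r $ k) = (\<Sum>k\<in>UNIV. if k = i then r $ k else 0)"
          by (intro sum.cong) (auto simp: axis_def)
        then show ?thesis by simp
      qed
      have diag: "of_real (A i i) = p $ i * q $ i" for i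
        using pq[of "axis i 1"] by (simp add: ax sel)
      have "of_real (A i j) + of_real (A j i) = p $ i * q $ j + p $ j * q $ i" for i j
      proof -
        have "of_real (A i i) + of_real (A i j) + of_real (A j i) + of_real (A j j) = (p $ i + p $ j) * (q $ i + q $ j)"
          using pq[of "axis i 1 + axis j 1"]
          by (simp add: map_simps inner_add_left inner_add_right ax distrib_right sum.distrib sel add_ac)
        then show ?thesis by (simp add: diag algebra_simps)
      qed
      then have "complexify Q = linear_poly (\<lambda>i. p $ i) * linear_poly (\<lambda>i. q $ i)"
        unfolding A(2) complexify_quadratic_poly linear_poly_mult by (intro quadratic_poly_eqI) simp
      then show False
        using irreducibleD[OF assms(2)] linear_poly_not_unit by blast
    qed
  qed
qed


section \<open>Existence of multipole representations\<close>

text \<open>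
  Lengths are absorbed into the scalar. A negative sign of the scalar is moved to the first factor,
  which exists because \<open>k \<ge> 1\<close>.
\<close>

lemma unit_vector_normalization:
  fixes w :: "nat \<Rightarrow> real ^ 3"
  assumes "k \<ge> 1"
  shows "\<exists>c' u. c' \<ge> 0 \<and> (\<forall>j\<in>{1..k}. norm (u j) = 1) \<and>
    (\<forall>v. c * (\<Prod>j\<in>{1..k}. w j \<bullet> v) = c' * (\<Prod>j\<in>{1..k}. u j \<bullet> v))"
proof (cases "\<exists>j\<in>{1..k}. w j = 0")
  case True
  then obtain i where i: "i \<in> {1..k}" "w i = 0" by blast
  then have "(\<Prod>j\<in>{1..k}. w j \<bullet> v) = 0" for v by (intro prod_zero bexI[of _ i]) simp_all
  then show ?thesis by (intro exI[of _ 0] exI[of _ "\<lambda>_. axis 1 1"]) simp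
next
  case False
  define c' where "c' = c * (\<Prod>j\<in>{1..k}. norm (w j))"
  define u where "u j = (if j = 1 \<and> c' < 0 then -1 else 1) *\<^sub>R (w j /\<^sub>R norm (w j))" for j
  have "c * (\<Prod>j\<in>{1..k}. w j \<bullet> v) = \<bar>c'\<bar> * (\<Prod>j\<in>{1..k}. u j \<bullet> v)" for v
  proof -
    have "(\<Prod>j\<in>{1..k}. w j \<bullet> v) = (\<Prod>j\<in>{1..k}. (if j = 1 then (if c' < 0 then -1 else 1) else 1) * (norm (w j) * (u j \<bullet> v)))"
      using False by (intro prod.cong) (auto simp: u_def)
    also have "\<dots> = (if c' < 0 then -1 else 1) * ((\<Prod>j\<in>{1..k}. norm (w j)) * (\<Prod>j\<in>{1..k}. u j \<bullet> v))"
      using assms by (simp add: prod.distrib prod.delta)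
    finally have "c * (\<Prod>j\<in>{1..k}. w j \<bullet> v) = (if c' < 0 then -1 else 1) * c' * (\<Prod>j\<in>{1..k}. u j \<bullet> v)"
      by (simp add: c'_def)
    then show ?thesis by (simp add: abs_if)
  qed
  moreover have "norm (u j) = 1" if "j \<in> {1..k}" for j
    using False that by (auto simp: u_def)
  ultimately show ?thesis by (intro exI[of _ "\<bar>c'\<bar>"] exI[of _ u]) simp
qed

theorem multipole_representation_exists:
  assumes "splits_on (quadric_surface Q)"
  shows "\<exists>c u. multipole_representation Q P (total_degree P) c u"
proof -
  let ?d = "total_degree P"
  obtain c w where cw: "\<And>v. v \<in> quadric_surface Q \<Longrightarrow>
      eval3 P v = c 0 + (\<Sum>k\<in>{1..?d}. c k * (\<Prod>j\<in>{1..k}. w k j \<bullet> v))"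
    using splits_on_representation[OF assms eval3_below] by blast
  have ex: "\<forall>k. \<exists>c' u. k \<ge> 1 \<longrightarrow> c' \<ge> 0 \<and> (\<forall>j\<in>{1..k}. norm (u j) = 1) \<and>
    (\<forall>v. c k * (\<Prod>j\<in>{1..k}. w k j \<bullet> v) = c' * (\<Prod>j\<in>{1..k}. u j \<bullet> v))"
  proof
    fix k
    show "\<exists>c' u. k \<ge> 1 \<longrightarrow> c' \<ge> 0 \<and> (\<forall>j\<in>{1..k}. norm (u j) = 1) \<and>
      (\<forall>v. c k * (\<Prod>j\<in>{1..k}. w k j \<bullet> v) = c' * (\<Prod>j\<in>{1..k}. u j \<bullet> v))"
    proof (cases "k \<ge> 1")
      case True
      then show ?thesis using unit_vector_normalization[OF True, of "c k" "w k"] by simp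
    qed simp
  qed
  from choice[OF ex] obtain c' where
    "\<forall>k. \<exists>u. k \<ge> 1 \<longrightarrow> c' k \<ge> 0 \<and> (\<forall>j\<in>{1..k}. norm (u j) = 1) \<and>
    (\<forall>v. c k * (\<Prod>j\<in>{1..k}. w k j \<bullet> v) = c' k * (\<Prod>j\<in>{1..k}. u j \<bullet> v))" by blast
  from choice[OF this] obtain u where u: "\<And>k. k \<ge> 1 \<Longrightarrow> c' k \<ge> 0 \<and> (\<forall>j\<in>{1..k}. norm (u k j) = 1) \<and>
    (\<forall>v. c k * (\<Prod>j\<in>{1..k}. w k j \<bullet> v) = c' k * (\<Prod>j\<in>{1..k}. u k j \<bullet> v))" by blast
  have "multipole_representation Q P ?d (c'(0 := c 0)) u"
    unfolding multipole_representation_def using u by (auto simp: cw intro!: sum.cong)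
  then show ?thesis by blast
qed

section \<open>Uniqueness of the leading multipole on an ellipsoid\<close>

text \<open>
  The linear form with coefficient vector \<open>u\<close> restricted to the parametrized null cone.
\<close>

definition null_poly :: "real ^ 3 \<Rightarrow> complex poly" where
  "null_poly u = [:(of_real (u $ 1) - \<i> * of_real (u $ 2)) / 2, of_real (u $ 3),
     - (of_real (u $ 1) + \<i> * of_real (u $ 2)) / 2:]"

lemma poly_null_poly: "poly (null_poly u) t = cdot u (conic_point t)"
  by (simp add: null_poly_def cdot_def sum_3 conic_point_nth power2_eq_square field_simps)

lemma null_poly_scale: "null_poly (\<mu> *\<^sub>R u) = smult (of_real \<mu>) (null_poly u)"
  by (simp add: null_poly_def algebra_simps)

lemma degree_null_poly_nonzero:
  assumes "u \<noteq> 0"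
  shows "degree (null_poly u) \<noteq> 0"
proof
  assume "degree (null_poly u) = 0"
  then have "coeff (null_poly u) 1 = 0" "coeff (null_poly u) 2 = 0"
    by (simp_all add: coeff_eq_0)
  then have "u $ 3 = 0" "of_real (u $ 1) + \<i> * of_real (u $ 2) = 0"
    by (simp_all add: null_poly_def numeral_2_eq_2)
  then have "u $ 1 = 0" "u $ 2 = 0" "u $ 3 = 0" by (simp_all add: complex_eq_iff)
  then show False using assms by (simp add: vec_eq_iff forall_3)
qed

lemma null_poly_root:
  assumes "u \<noteq> 0"
  obtains t where "poly (null_poly u) t = 0"
proof -
  have "\<not> constant (poly (null_poly u))"
    using degree_null_poly_nonzero[OF assms] by (simp add: constant_degree)
  then show thesis using that fundamental_theorem_of_algebra by blast
qed

lemma null_poly_nonzero: "u \<noteq> 0 \<Longrightarrow> null_poly u \<noteq> 0"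
  using degree_null_poly_nonzero by fastforce

text \<open>
  A real linear form that vanishes at a null vector is orthogonal to its real and imaginary parts. These
  are linearly independent, so the coefficient vector lies on a fixed line.
\<close>

lemma null_poly_common_root:
  assumes "u \<noteq> 0" "poly (null_poly u) t = 0" "poly (null_poly u') t = 0"
  obtains \<mu> where "u' = \<mu> *\<^sub>R u"
proof -
  obtain s e f where ef: "s > 0" "norm e = 1" "norm f = 1" "e \<bullet> f = 0"
    "conic_point t = (\<chi> i. of_real s * (of_real (e $ i) + \<i> * of_real (f $ i)))"
    by (rule null_vector_frame[OF conic_point_null[of t] conic_point_nonzero])
  have "cdot w (conic_point t) = of_real s * (of_real (e \<bullet> w) + \<i> * of_real (f \<bullet> w))" for w
    unfolding ef(5) cdot_def
    by (simp add: inner_vec_def sum_distrib_left sum.distrib algebra_simps)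
  then have "e \<bullet> w = 0 \<and> f \<bullet> w = 0" if "poly (null_poly w) t = 0" for w
    using that ef(1) by (simp add: poly_null_poly complex_eq_iff)
  then have par: "w = ((cross3 e f) \<bullet> w) *\<^sub>R (cross3 e f)" if "poly (null_poly w) t = 0" for w
    using orthonormal_expansion[OF ef(2-4), of w] that by simp
  define a where "a = (cross3 e f) \<bullet> u"
  define n where "n = cross3 e f"
  have u: "u = a *\<^sub>R n" "u' = (n \<bullet> u') *\<^sub>R n"
    using par assms(2,3) unfolding a_def n_def by blast+
  then have "a \<noteq> 0" using assms(1) by auto
  then have "u' = ((n \<bullet> u') / a) *\<^sub>R u" by (subst u(2), subst u(1)) simp
  then show thesis by (rule that)
qed

text \<open>
  A root of one factor on the right is a root of some factor on the left. By
  \<open>null_poly_common_root\<close> the two factors are proportional and can be cancelled.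
\<close>

lemma null_poly_unique_factorization:
  fixes u :: "'a \<Rightarrow> real ^ 3" and u' :: "'b \<Rightarrow> real ^ 3"
  assumes "finite B" "finite A" "card A = card B" "c \<noteq> 0"
    "\<And>a. a \<in> A \<Longrightarrow> u a \<noteq> 0" "\<And>b. b \<in> B \<Longrightarrow> u' b \<noteq> 0"
    "smult (of_real c) (\<Prod>a\<in>A. null_poly (u a)) = smult (of_real c') (\<Prod>b\<in>B. null_poly (u' b))"
  shows "\<exists>\<sigma> \<mu>. bij_betw \<sigma> B A \<and> (\<forall>b\<in>B. u' b = \<mu> b *\<^sub>R u (\<sigma> b)) \<and> c = c' * (\<Prod>b\<in>B. \<mu> b)"
  using assms
proof (induction B arbitrary: A c' rule: finite_induct)
  case empty
  then show ?case by (simp add: bij_betw_def)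
next
  case (insert b B)
  obtain t where t: "poly (null_poly (u' b)) t = 0"
    using null_poly_root insert.prems(5) by blast
  have "poly (smult (of_real c) (\<Prod>a\<in>A. null_poly (u a))) t = 0"
    unfolding insert.prems(6) using insert.hyps t by (simp add: poly_prod)
  then obtain a where a: "a \<in> A" "poly (null_poly (u a)) t = 0"
    using insert.prems(1,3) by (auto simp: poly_prod)
  obtain m where m: "u' b = m *\<^sub>R u a"
    using null_poly_common_root[OF insert.prems(4)[OF a(1)] a(2) t] by blast
  have "null_poly (u a) * smult (of_real c) (\<Prod>a\<in>A - {a}. null_poly (u a)) =
      smult (of_real c) (\<Prod>a\<in>A. null_poly (u a))"
    using insert.prems(1) a(1) by (simp add: prod.remove)
  also have "\<dots> = null_poly (u a) * smult (of_real (c' * m)) (\<Prod>b\<in>B. null_poly (u' b))"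
    unfolding insert.prems(6) using insert.hyps by (simp add: m null_poly_scale)
  finally have "smult (of_real c) (\<Prod>a\<in>A - {a}. null_poly (u a)) =
      smult (of_real (c' * m)) (\<Prod>b\<in>B. null_poly (u' b))"
    using null_poly_nonzero[OF insert.prems(4)[OF a(1)]] mult_left_cancel by blast
  moreover have "card (A - {a}) = card B"
    using insert.prems(1,2) insert.hyps a(1) by simp
  ultimately have "\<exists>\<sigma> \<mu>. bij_betw \<sigma> B (A - {a}) \<and> (\<forall>b\<in>B. u' b = \<mu> b *\<^sub>R u (\<sigma> b)) \<and>
      c = c' * m * (\<Prod>b\<in>B. \<mu> b)"
    using insert.prems(1,3-5) by (intro insert.IH) auto
  then obtain \<sigma> \<mu> where IH: "bij_betw \<sigma> B (A - {a})" "\<And>b. b \<in> B \<Longrightarrow> u' b = \<mu> b *\<^sub>R u (\<sigma> b)"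
    "c = c' * m * (\<Prod>b\<in>B. \<mu> b)"
    by blast
  have cong: "(\<sigma>(b := a)) x = \<sigma> x" "(\<mu>(b := m)) x = \<mu> x" if "x \<in> B" for x
    using that insert.hyps by auto
  have "bij_betw (\<sigma>(b := a)) B (A - {a})"
    using IH(1) cong(1) by (simp cong: bij_betw_cong)
  then have "bij_betw (\<sigma>(b := a)) (insert b B) (insert a (A - {a}))"
    using notIn_Un_bij_betw[of b B "\<sigma>(b := a)" "A - {a}"] insert.hyps(2) by simp
  then have "bij_betw (\<sigma>(b := a)) (insert b B) A"
    using a(1) by (simp add: insert_absorb)
  moreover have "(\<Prod>x\<in>B. (\<mu>(b := m)) x) = (\<Prod>x\<in>B. \<mu> x)"
    by (rule prod.cong[OF refl]) (rule cong(2))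
  then have "c = c' * (\<Prod>x\<in>insert b B. (\<mu>(b := m)) x)"
    using insert.hyps IH(3) by simp
  moreover have "\<forall>x\<in>insert b B. u' x = (\<mu>(b := m)) x *\<^sub>R u ((\<sigma>(b := a)) x)"
    using IH(2) m cong by auto
  ultimately show ?case by blast
qed

text \<open>
  With \<open>a = e1 + \<i> e2\<close> and \<open>z = cis \<theta>\<close>, the point \<open>cos \<theta> e1 + sin \<theta> e2\<close> of the circle is half of
  \<open>z\<close> times the conjugate of \<open>a\<close> plus half of \<open>a / z\<close>. After multiplication by \<open>z ^ d\<close> everything is a
  polynomial in \<open>z\<close>, and at \<open>z = 0\<close> neither the terms with \<open>k < d\<close> nor the translation \<open>x0\<close> contribute.
\<close>

lemma circle_polynomial:
  fixes f :: "real ^ 3 \<Rightarrow> real ^ 3" and c :: "nat \<Rightarrow> real" and u :: "nat \<Rightarrow> nat \<Rightarrow> real ^ 3"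
    and d :: nat
  assumes "linear f"
  shows "\<exists>p. (\<forall>\<theta>. poly p (cis \<theta>) = cis \<theta> ^ d *
      of_real (\<Sum>k\<le>d. c k * (\<Prod>j\<in>{1..k}. u k j \<bullet> (x0 + f (cos \<theta> *\<^sub>R e1 + sin \<theta> *\<^sub>R e2))))) \<and>
    poly p 0 = of_real (c d) * (\<Prod>j\<in>{1..d}. cdot (adjoint f (u d j)) (\<chi> i. of_real (e1 $ i) + \<i> * of_real (e2 $ i)) / 2)"
proof -
  define \<alpha> where "\<alpha> w = of_real (w \<bullet> f e1) + \<i> * of_real (w \<bullet> f e2)" for w
  define q where "q w = [:\<alpha> w / 2, of_real (w \<bullet> x0), cnj (\<alpha> w) / 2:]" for w
  define p where "p = (\<Sum>k\<le>d. [:0, 1:] ^ (d - k) * smult (of_real (c k)) (\<Prod>j\<in>{1..k}. q (u k j)))"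
  have adj: "cdot (adjoint f w) (\<chi> i. of_real (e1 $ i) + \<i> * of_real (e2 $ i)) = \<alpha> w" for w
  proof -
    have "cdot (adjoint f w) (\<chi> i. of_real (e1 $ i) + \<i> * of_real (e2 $ i)) =
        of_real (adjoint f w \<bullet> e1) + \<i> * of_real (adjoint f w \<bullet> e2)"
      by (simp add: cdot_def inner_vec_def sum_distrib_left sum.distrib algebra_simps)
    then show ?thesis by (simp add: adjoint_clauses(2)[OF assms] \<alpha>_def)
  qed
  have q: "poly (q w) (cis \<theta>) = cis \<theta> * of_real (w \<bullet> (x0 + f (cos \<theta> *\<^sub>R e1 + sin \<theta> *\<^sub>R e2)))" for w \<theta>
  proof -
    let ?z = "cis \<theta>"
    have zz: "?z * cnj ?z = 1" by (simp add: cis_cnj cis_mult)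
    have re: "of_real (w \<bullet> f (cos \<theta> *\<^sub>R e1 + sin \<theta> *\<^sub>R e2)) = (?z * cnj (\<alpha> w) + cnj ?z * \<alpha> w) / 2"
      by (simp add: linear_add[OF assms] linear_scale[OF assms] inner_add_right complex_eq_iff \<alpha>_def)
    have "cis \<theta> * of_real (w \<bullet> (x0 + f (cos \<theta> *\<^sub>R e1 + sin \<theta> *\<^sub>R e2))) =
        ?z * of_real (w \<bullet> x0) + (?z * ?z * cnj (\<alpha> w) + (?z * cnj ?z) * \<alpha> w) / 2"
      unfolding inner_add_right of_real_add re by (simp add: algebra_simps add_divide_distrib)
    then show ?thesis unfolding zz by (simp add: q_def algebra_simps add_divide_distrib)
  qed
  have "poly p (cis \<theta>) = cis \<theta> ^ d *
      of_real (\<Sum>k\<le>d. c k * (\<Prod>j\<in>{1..k}. u k j \<bullet> (x0 + f (cos \<theta> *\<^sub>R e1 + sin \<theta> *\<^sub>R e2))))" for \<theta>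
  proof -
    have "poly p (cis \<theta>) = (\<Sum>k\<le>d. cis \<theta> ^ (d - k) * (of_real (c k) * (cis \<theta> ^ k *
        of_real (\<Prod>j\<in>{1..k}. u k j \<bullet> (x0 + f (cos \<theta> *\<^sub>R e1 + sin \<theta> *\<^sub>R e2))))))"
      by (simp add: p_def poly_sum poly_prod q prod.distrib mult_ac del: DeMoivre)
    also have "\<dots> = (\<Sum>k\<le>d. cis \<theta> ^ d * of_real (c k * (\<Prod>j\<in>{1..k}. u k j \<bullet> (x0 + f (cos \<theta> *\<^sub>R e1 + sin \<theta> *\<^sub>R e2)))))"
    proof (rule sum.cong)
      fix k assume "k \<in> {..d}"
      then have "cis \<theta> ^ d = cis \<theta> ^ (d - k) * cis \<theta> ^ k" by (simp flip: power_add)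
      then show "cis \<theta> ^ (d - k) * (of_real (c k) * (cis \<theta> ^ k *
        of_real (\<Prod>j\<in>{1..k}. u k j \<bullet> (x0 + f (cos \<theta> *\<^sub>R e1 + sin \<theta> *\<^sub>R e2))))) =
        cis \<theta> ^ d * of_real (c k * (\<Prod>j\<in>{1..k}. u k j \<bullet> (x0 + f (cos \<theta> *\<^sub>R e1 + sin \<theta> *\<^sub>R e2))))"
        by (simp only: of_real_mult mult_ac)
    qed simp
    finally show ?thesis by (simp add: sum_distrib_left)
  qed
  moreover have "poly p 0 = of_real (c d) * (\<Prod>j\<in>{1..d}. \<alpha> (u d j) / 2)"
  proof -
    have "poly p 0 = (\<Sum>k\<le>d. if k = d then of_real (c k) * (\<Prod>j\<in>{1..k}. \<alpha> (u k j) / 2) else 0)"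
      unfolding p_def poly_sum by (intro sum.cong) (auto simp: poly_prod q_def)
    then show ?thesis by simp
  qed
  ultimately show ?thesis unfolding adj by blast
qed

lemma infinite_range_cis: "infinite (range cis)"
proof
  assume "finite (range cis)"
  then have "finite (Re ` range cis)" by (rule finite_imageI)
  moreover have "{-1..1::real} \<subseteq> Re ` range cis"
  proof
    fix x :: real assume "x \<in> {-1..1}"
    then have "x = Re (cis (arccos x))" by simp
    then show "x \<in> Re ` range cis" by blast
  qed
  ultimately have "finite {-1..1::real}" by (rule rev_finite_subset)
  then show False using infinite_Icc[of "- 1 :: real" 1] by simp
qed

text \<open>
  Each complex null vector spans the same line as some \<open>e1 + \<i> e2\<close> with \<open>e1\<close>, \<open>e2\<close> orthonormal. The
  polynomials of \<open>circle_polynomial\<close> for the two representations agree on the unit circle, so they are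
  equal, and their values at \<open>0\<close> are the leading products at \<open>e1 + \<i> e2\<close>.
\<close>

lemma ellipsoid_leading_terms:
  fixes f :: "real ^ 3 \<Rightarrow> real ^ 3" and d :: nat
  assumes f: "linear f" and eq: "\<And>v. v \<in> (\<lambda>v. x0 + f v) ` sphere 0 1 \<Longrightarrow>
      (\<Sum>k\<le>d. c k * (\<Prod>j\<in>{1..k}. u k j \<bullet> v)) = (\<Sum>k\<le>d. c' k * (\<Prod>j\<in>{1..k}. u' k j \<bullet> v))"
  shows "smult (of_real (c d)) (\<Prod>j\<in>{1..d}. null_poly (adjoint f (u d j))) =
    smult (of_real (c' d)) (\<Prod>j\<in>{1..d}. null_poly (adjoint f (u' d j)))"
proof (rule poly_ext)
  fix t
  obtain s e1 e2 where ef: "s > 0" "norm e1 = 1" "norm e2 = 1" "e1 \<bullet> e2 = 0"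
    "conic_point t = (\<chi> i. of_real s * (of_real (e1 $ i) + \<i> * of_real (e2 $ i)))"
    by (rule null_vector_frame[OF conic_point_null[of t] conic_point_nonzero])
  let ?a = "\<chi> i. of_real (e1 $ i) + \<i> * of_real (e2 $ i)"
  obtain p where p: "\<And>\<theta>. poly p (cis \<theta>) = cis \<theta> ^ d *
      of_real (\<Sum>k\<le>d. c k * (\<Prod>j\<in>{1..k}. u k j \<bullet> (x0 + f (cos \<theta> *\<^sub>R e1 + sin \<theta> *\<^sub>R e2))))"
    "poly p 0 = of_real (c d) * (\<Prod>j\<in>{1..d}. cdot (adjoint f (u d j)) ?a / 2)"
    using circle_polynomial[OF f, of d c u x0 e1 e2] by blast
  obtain p' where p': "\<And>\<theta>. poly p' (cis \<theta>) = cis \<theta> ^ d *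
      of_real (\<Sum>k\<le>d. c' k * (\<Prod>j\<in>{1..k}. u' k j \<bullet> (x0 + f (cos \<theta> *\<^sub>R e1 + sin \<theta> *\<^sub>R e2))))"
    "poly p' 0 = of_real (c' d) * (\<Prod>j\<in>{1..d}. cdot (adjoint f (u' d j)) ?a / 2)"
    using circle_polynomial[OF f, of d c' u' x0 e1 e2] by blast
  have "poly p (cis \<theta>) = poly p' (cis \<theta>)" for \<theta>
  proof -
    let ?v = "cos \<theta> *\<^sub>R e1 + sin \<theta> *\<^sub>R e2"
    have "e1 \<bullet> e1 = 1" "e2 \<bullet> e2 = 1" using ef by (simp_all add: norm_eq_1)
    then have "?v \<bullet> ?v = (cos \<theta>)\<^sup>2 + (sin \<theta>)\<^sup>2"
      using ef(4) by (simp add: inner_add_left inner_add_right inner_commute power2_eq_square)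
    then have "?v \<in> sphere 0 1" by (simp add: norm_eq_1)
    then have "x0 + f ?v \<in> (\<lambda>v. x0 + f v) ` sphere 0 1" by (rule imageI)
    then show ?thesis unfolding p(1) p'(1) by (simp only: eq)
  qed
  then have "range cis \<subseteq> {z. poly (p - p') z = 0}" by auto
  then have "infinite {z. poly (p - p') z = 0}" using infinite_range_cis finite_subset by blast
  then have "p - p' = 0" using poly_roots_finite by blast
  then have "poly p 0 = poly p' 0" by simp
  then have top: "of_real (c d) * (\<Prod>j\<in>{1..d}. cdot (adjoint f (u d j)) ?a) =
     of_real (c' d) * (\<Prod>j\<in>{1..d}. cdot (adjoint f (u' d j)) ?a)"
    unfolding p(2) p'(2) by (simp add: prod_dividef)
  have "poly (null_poly w) t = of_real s * cdot w ?a" for w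
    unfolding poly_null_poly ef(5) by (simp add: cdot_def sum_distrib_left mult_ac)
  then show "poly (smult (of_real (c d)) (\<Prod>j\<in>{1..d}. null_poly (adjoint f (u d j)))) t =
      poly (smult (of_real (c' d)) (\<Prod>j\<in>{1..d}. null_poly (adjoint f (u' d j)))) t"
    using top by (simp add: poly_prod prod.distrib mult.left_commute)
qed

lemma multipole_relI:
  assumes "s \<in> multipole_tuples k" "t \<in> multipole_tuples k" "\<sigma> permutes {1..k}"
    "(\<Prod>j\<in>{1..k}. \<mu> j) = (1::real)" "\<And>j. j \<in> {1..k} \<Longrightarrow> t j = \<mu> j *\<^sub>R s (\<sigma> j)"
  shows "(s, t) \<in> multipole_rel k"
  using assms unfolding multipole_rel_def by blast

text \<open>
  Proportional unit vectors differ by a factor \<open>1\<close> or \<open>- 1\<close>. As \<open>c\<close> and \<open>c'\<close> are non-negative,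
  the product of these factors is \<open>1\<close> unless \<open>c = 0\<close>. The map \<open>g\<close> accommodates ellipsoids, for which
  the coefficient vectors have to be transported to the sphere.
\<close>

lemma multipole_determined_by_null_polys:
  fixes g :: "real ^ 3 \<Rightarrow> real ^ 3"
  assumes g: "linear g" "inj g" and c: "c \<ge> 0" "c' \<ge> 0"
    and u: "\<And>j. j \<in> {1..k} \<Longrightarrow> norm (u j) = 1" and u': "\<And>j. j \<in> {1..k} \<Longrightarrow> norm (u' j) = 1"
    and eq: "smult (of_real c) (\<Prod>j\<in>{1..k}. null_poly (g (u j))) =
      smult (of_real c') (\<Prod>j\<in>{1..k}. null_poly (g (u' j)))"
  shows "c = c' \<and> (c \<noteq> 0 \<longrightarrow> (restrict u {1..k}, restrict u' {1..k}) \<in> multipole_rel k)"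
proof -
  have g0: "g v \<noteq> 0" if "norm v = 1" for v
  proof -
    have "v \<noteq> 0" using that by auto
    then show ?thesis using g linear_injective_0[OF g(1)] by blast
  qed
  have nz: "g (u j) \<noteq> 0" "g (u' j) \<noteq> 0" if "j \<in> {1..k}" for j
    using g0[OF u[OF that]] g0[OF u'[OF that]] by simp_all
  show ?thesis
  proof (cases "c = 0")
    case True
    have "c' = 0"
    proof (rule ccontr)
      assume "c' \<noteq> 0"
      then have "\<exists>\<sigma> \<mu>. bij_betw \<sigma> {1..k} {1..k} \<and> (\<forall>b\<in>{1..k}. g (u b) = \<mu> b *\<^sub>R g (u' (\<sigma> b))) \<and> c' = c * (\<Prod>b\<in>{1..k}. \<mu> b)"
        using nz eq
        by (intro null_poly_unique_factorization[where u = "\<lambda>j. g (u' j)" and u' = "\<lambda>j. g (u j)"]) simp_all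
      then show False using True \<open>c' \<noteq> 0\<close> by auto
    qed
    then show ?thesis using True by simp
  next
    case False
    then have "\<exists>\<sigma> \<mu>. bij_betw \<sigma> {1..k} {1..k} \<and> (\<forall>b\<in>{1..k}. g (u' b) = \<mu> b *\<^sub>R g (u (\<sigma> b))) \<and> c = c' * (\<Prod>b\<in>{1..k}. \<mu> b)"
      using nz eq
      by (intro null_poly_unique_factorization[where u = "\<lambda>j. g (u j)" and u' = "\<lambda>j. g (u' j)"]) simp_all
    then obtain \<sigma> \<mu> where \<sigma>: "bij_betw \<sigma> {1..k} {1..k}" and
      g\<mu>: "\<And>b. b \<in> {1..k} \<Longrightarrow> g (u' b) = \<mu> b *\<^sub>R g (u (\<sigma> b))" and c\<mu>: "c = c' * (\<Prod>b\<in>{1..k}. \<mu> b)"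
      by blast
    have \<sigma>k: "\<sigma> b \<in> {1..k}" if "b \<in> {1..k}" for b
      using \<sigma> that by (rule bij_betwE[rule_format])
    have u\<mu>: "u' b = \<mu> b *\<^sub>R u (\<sigma> b)" if "b \<in> {1..k}" for b
      by (rule injD[OF g(2)]) (simp add: g\<mu>[OF that] linear_scale[OF g(1)])
    have "\<bar>\<mu> b\<bar> = 1" if "b \<in> {1..k}" for b
      using arg_cong[OF u\<mu>[OF that], of norm] u[OF \<sigma>k[OF that]] u'[OF that] by simp
    then have "\<bar>\<Prod>b\<in>{1..k}. \<mu> b\<bar> = 1" unfolding abs_prod by simp
    then have "\<bar>c\<bar> = \<bar>c'\<bar>" by (simp add: c\<mu> abs_mult)
    then have cc: "c = c'" using c by simp
    then have prod: "(\<Prod>b\<in>{1..k}. \<mu> b) = 1" using c\<mu> False by simp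
    define \<tau> where "\<tau> j = (if j \<in> {1..k} then \<sigma> j else j)" for j
    have "\<tau> permutes {1..k}"
    proof (rule bij_imp_permutes)
      show "bij_betw \<tau> {1..k} {1..k}"
        using \<sigma> bij_betw_cong[of "{1..k}" \<tau> \<sigma> "{1..k}"] by (simp add: \<tau>_def)
    qed (auto simp: \<tau>_def)
    moreover have "restrict u {1..k} \<in> multipole_tuples k" "restrict u' {1..k} \<in> multipole_tuples k"
      using u u' by (force simp: multipole_tuples_def)+
    moreover have "restrict u' {1..k} j = \<mu> j *\<^sub>R restrict u {1..k} (\<tau> j)" if "j \<in> {1..k}" for j
      using u\<mu>[OF that] \<sigma>k[OF that] that by (simp add: \<tau>_def)
    ultimately have "(restrict u {1..k}, restrict u' {1..k}) \<in> multipole_rel k"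
      using prod by (intro multipole_relI[where \<sigma> = \<tau> and \<mu> = \<mu>])
    then show ?thesis using cc by simp
  qed
qed


section \<open>Uniqueness of the representation and of its multipoles\<close>

definition unit_coefficients :: "nat \<Rightarrow> (nat \<Rightarrow> real) \<Rightarrow> (nat \<Rightarrow> nat \<Rightarrow> real ^ 3) \<Rightarrow> bool" where
  "unit_coefficients d c u \<longleftrightarrow> (\<forall>k\<in>{1..d}. c k \<ge> 0 \<and> (\<forall>j\<in>{1..k}. norm (u k j) = 1))"

text \<open>
  The leading terms coincide, both as multipoles and as functions, and cancel; the remaining
  representations have smaller degree.
\<close>

lemma ellipsoid_uniqueness:
  assumes "ellipsoid E" "unit_coefficients d c u" "unit_coefficients d c' u'"
    "\<And>v. v \<in> E \<Longrightarrow> c 0 + (\<Sum>k\<in>{1..d}. c k * (\<Prod>j\<in>{1..k}. u k j \<bullet> v)) =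
       c' 0 + (\<Sum>k\<in>{1..d}. c' k * (\<Prod>j\<in>{1..k}. u' k j \<bullet> v))"
  shows "(\<forall>k\<le>d. c k = c' k) \<and> (\<forall>k\<in>{1..d}. c k \<noteq> 0 \<longrightarrow>
      (restrict (u k) {1..k}, restrict (u' k) {1..k}) \<in> multipole_rel k)"
  using assms(2-4)
proof (induction d)
  case 0
  obtain x0 and f :: "real ^ 3 \<Rightarrow> real ^ 3" where "E = (\<lambda>v. x0 + f v) ` sphere 0 1"
    using assms(1) unfolding ellipsoid_def by blast
  then have "E \<noteq> {}" by simp
  then show ?case using 0(3) by auto
next
  case (Suc d)
  obtain x0 and f :: "real ^ 3 \<Rightarrow> real ^ 3" where f: "linear f" "bij f"
    and E: "E = (\<lambda>v. x0 + f v) ` sphere 0 1"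
    using assms(1) unfolding ellipsoid_def by blast
  have inj: "inj (adjoint f)"
    unfolding linear_injective_0[OF adjoint_linear[OF f(1)]]
  proof (intro allI impI)
    fix w assume "adjoint f w = 0"
    then have "w \<bullet> f v = 0" for v using adjoint_clauses(2)[OF f(1), of w v] by simp
    then have "w \<bullet> w = 0" using bij_is_surj[OF f(2)] by (metis surjD)
    then show "w = 0" by simp
  qed
  have shift: "b 0 + (\<Sum>k\<in>{1..n}. b k * (\<Prod>j\<in>{1..k}. w k j \<bullet> v)) = (\<Sum>k\<le>n. b k * (\<Prod>j\<in>{1..k}. w k j \<bullet> v))"
    for b :: "nat \<Rightarrow> real" and w :: "nat \<Rightarrow> nat \<Rightarrow> real ^ 3" and n v
  proof -
    have "{..n} = insert 0 {1..n}" by auto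
    then show ?thesis by simp
  qed
  let ?n = "Suc d"
  have lead: "c ?n = c' ?n \<and> (c ?n \<noteq> 0 \<longrightarrow> (restrict (u ?n) {1..?n}, restrict (u' ?n) {1..?n}) \<in> multipole_rel ?n)"
  proof (rule multipole_determined_by_null_polys[OF adjoint_linear[OF f(1)] inj])
    show "smult (of_real (c ?n)) (\<Prod>j\<in>{1..?n}. null_poly (adjoint f (u ?n j))) =
      smult (of_real (c' ?n)) (\<Prod>j\<in>{1..?n}. null_poly (adjoint f (u' ?n j)))"
      by (rule ellipsoid_leading_terms[OF f(1)]) (use Suc.prems(3) in \<open>simp only: E shift\<close>)
  qed (use Suc.prems(1,2) in \<open>auto simp: unit_coefficients_def\<close>)
  have prod: "c ?n * (\<Prod>j\<in>{1..?n}. u ?n j \<bullet> v) = c' ?n * (\<Prod>j\<in>{1..?n}. u' ?n j \<bullet> v)" for v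
  proof (cases "c ?n = 0")
    case False
    then have "(\<Prod>j\<in>{1..?n}. restrict (u ?n) {1..?n} j \<bullet> v) = (\<Prod>j\<in>{1..?n}. restrict (u' ?n) {1..?n} j \<bullet> v)"
      using lead by (intro multipole_rel_prod) blast
    then have "(\<Prod>j\<in>{1..?n}. u ?n j \<bullet> v) = (\<Prod>j\<in>{1..?n}. u' ?n j \<bullet> v)"
      by (simp cong: prod.cong_simp)
    then show ?thesis using lead by simp
  qed (use lead in simp)
  have "unit_coefficients d c u" "unit_coefficients d c' u'"
    using Suc.prems(1,2) by (auto simp: unit_coefficients_def)
  moreover have "c 0 + (\<Sum>k\<in>{1..d}. c k * (\<Prod>j\<in>{1..k}. u k j \<bullet> v)) =
       c' 0 + (\<Sum>k\<in>{1..d}. c' k * (\<Prod>j\<in>{1..k}. u' k j \<bullet> v))" if "v \<in> E" for v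
  proof -
    have "(\<Sum>k\<in>{1..?n}. g k) = (\<Sum>k\<in>{1..d}. g k) + g ?n" for g :: "nat \<Rightarrow> real" by simp
    note split = this
    show ?thesis using Suc.prems(3)[OF that] prod[of v] unfolding split by linarith
  qed
  ultimately have IH: "(\<forall>k\<le>d. c k = c' k) \<and> (\<forall>k\<in>{1..d}. c k \<noteq> 0 \<longrightarrow>
      (restrict (u k) {1..k}, restrict (u' k) {1..k}) \<in> multipole_rel k)"
    by (rule Suc.IH)
  show ?case
  proof (intro conjI allI ballI impI)
    show "c k = c' k" if "k \<le> ?n" for k
      using IH lead that by (cases "k = ?n") auto
    show "(restrict (u k) {1..k}, restrict (u' k) {1..k}) \<in> multipole_rel k"
      if "k \<in> {1..?n}" "c k \<noteq> 0" for k
    proof (cases "k = ?n")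
      case True
      then show ?thesis using lead that by blast
    next
      case False
      then have "k \<in> {1..d}" using that by auto
      then show ?thesis using IH that by blast
    qed
  qed
qed

lemma multipole_rel_equiv: "equiv (multipole_tuples k) (multipole_rel k)"
proof (rule equivI)
  show "multipole_rel k \<subseteq> multipole_tuples k \<times> multipole_tuples k"
    by (auto simp: multipole_rel_def)
  show "refl_on (multipole_tuples k) (multipole_rel k)"
  proof (rule refl_onI)
    fix s assume "s \<in> multipole_tuples k"
    then show "(s, s) \<in> multipole_rel k"
      by (intro multipole_relI[of s k s id "\<lambda>_. 1"]) (auto simp: permutes_id)
  qed
  show "sym (multipole_rel k)"
  proof (rule symI)
    fix s t assume st: "(s, t) \<in> multipole_rel k"
    then obtain \<sigma> \<mu> where 1: "\<sigma> permutes {1..k}" "(\<Prod>j\<in>{1..k}. \<mu> j) = (1::real)"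
      "\<And>j. j \<in> {1..k} \<Longrightarrow> t j = \<mu> j *\<^sub>R s (\<sigma> j)"
      by (auto simp: multipole_rel_def)
    let ?\<tau> = "inv \<sigma>"
    have \<tau>: "?\<tau> permutes {1..k}" using 1(1) by (rule permutes_inv)
    have "(\<Prod>j\<in>{1..k}. inverse (\<mu> (?\<tau> j))) = inverse (\<Prod>j\<in>{1..k}. \<mu> (?\<tau> j))"
      by (simp flip: prod_inversef add: comp_def)
    also have "(\<Prod>j\<in>{1..k}. \<mu> (?\<tau> j)) = 1"
      using prod.permute[OF \<tau>, of \<mu>] 1(2) by (simp add: comp_def)
    finally have "(\<Prod>j\<in>{1..k}. inverse (\<mu> (?\<tau> j))) = 1" by simp
    moreover have "s j = inverse (\<mu> (?\<tau> j)) *\<^sub>R t (?\<tau> j)" if "j \<in> {1..k}" for j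
    proof -
      have j: "?\<tau> j \<in> {1..k}" using \<tau> that by (simp only: permutes_in_image)
      have "\<mu> (?\<tau> j) \<noteq> 0"
        using 1(2) j by (metis finite_atLeastAtMost prod_zero_iff zero_neq_one)
      then show ?thesis
        using 1(3)[OF j] permutes_inverses(1)[OF 1(1)] by simp
    qed
    ultimately show "(t, s) \<in> multipole_rel k"
      using st \<tau>
      by (intro multipole_relI[of t k s ?\<tau> "\<lambda>j. inverse (\<mu> (?\<tau> j))"]) (auto simp: multipole_rel_def)
  qed
  show "trans (multipole_rel k)"
  proof (rule transI)
    fix r s t assume rs: "(r, s) \<in> multipole_rel k" and st: "(s, t) \<in> multipole_rel k"
    obtain \<sigma> \<mu> where 1: "\<sigma> permutes {1..k}" "(\<Prod>j\<in>{1..k}. \<mu> j) = (1::real)"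
      "\<And>j. j \<in> {1..k} \<Longrightarrow> s j = \<mu> j *\<^sub>R r (\<sigma> j)"
      using rs by (auto simp: multipole_rel_def)
    obtain \<tau> \<nu> where 2: "\<tau> permutes {1..k}" "(\<Prod>j\<in>{1..k}. \<nu> j) = (1::real)"
      "\<And>j. j \<in> {1..k} \<Longrightarrow> t j = \<nu> j *\<^sub>R s (\<tau> j)"
      using st by (auto simp: multipole_rel_def)
    have "(\<Prod>j\<in>{1..k}. \<mu> (\<tau> j)) = 1"
      using prod.permute[OF 2(1), of \<mu>] 1(2) by (simp add: comp_def)
    then have "(\<Prod>j\<in>{1..k}. \<nu> j * \<mu> (\<tau> j)) = 1" using 2(2) by (simp add: prod.distrib)
    moreover have "t j = (\<nu> j * \<mu> (\<tau> j)) *\<^sub>R r ((\<sigma> \<circ> \<tau>) j)" if "j \<in> {1..k}" for j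
    proof -
      have "\<tau> j \<in> {1..k}" using 2(1) that by (simp only: permutes_in_image)
      then show ?thesis using 1(3) 2(3)[OF that] by simp
    qed
    moreover have "\<sigma> \<circ> \<tau> permutes {1..k}" using 2(1) 1(1) by (rule permutes_compose)
    moreover have "r \<in> multipole_tuples k" "t \<in> multipole_tuples k"
      using rs st by (auto simp: multipole_rel_def)
    ultimately show "(r, t) \<in> multipole_rel k"
      by (intro multipole_relI[of r k t "\<sigma> \<circ> \<tau>" "\<lambda>j. \<nu> j * \<mu> (\<tau> j)"])
  qed
qed

lemma absorbed_factor_tuple:
  assumes "c \<noteq> 0" "\<And>j. j \<in> {1..k} \<Longrightarrow> u j \<noteq> 0"
  shows "(\<lambda>j\<in>{1..k}. if j = 1 then c *\<^sub>R u j else u j) \<in> multipole_tuples k"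
  using assms by (auto simp: multipole_tuples_def)

lemma associated_multipole_in_space:
  assumes "\<And>j. j \<in> {1..k} \<Longrightarrow> u j \<noteq> 0"
  shows "associated_multipole k c u \<in> extended_multipole_space k"
  using absorbed_factor_tuple[OF _ assms, of c k]
  by (auto simp: associated_multipole_def extended_multipole_space_def multipole_space_def intro!: quotientI)

text \<open>
  If the permutation moves the first factor, the absorbed scalar moves to another place; the
  rescaling by \<open>a j / a (\<sigma> j)\<close> compensates for this and has product \<open>1\<close>.
\<close>

lemma associated_multipole_eq:
  assumes "k \<ge> 1" "c \<noteq> 0 \<Longrightarrow> (restrict u {1..k}, restrict u' {1..k}) \<in> multipole_rel k"
  shows "associated_multipole k c u = associated_multipole k c u'"
proof (cases "c = 0")
  case False
  define a where "a j = (if j = 1 then c else 1)" for j :: nat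
  have a: "a j \<noteq> 0" for j using False by (simp add: a_def)
  have "(restrict u {1..k}, restrict u' {1..k}) \<in> multipole_rel k" using assms(2) False by blast
  then obtain \<sigma> \<mu> where 1: "\<sigma> permutes {1..k}" "(\<Prod>j\<in>{1..k}. \<mu> j) = (1::real)"
    "\<forall>j\<in>{1..k}. restrict u' {1..k} j = \<mu> j *\<^sub>R restrict u {1..k} (\<sigma> j)"
    and tup: "restrict u {1..k} \<in> multipole_tuples k" "restrict u' {1..k} \<in> multipole_tuples k"
    unfolding multipole_rel_def by blast
  have nz: "u j \<noteq> 0" "u' j \<noteq> 0" if "j \<in> {1..k}" for j
    using tup that by (auto simp: multipole_tuples_def PiE_iff)
  have \<sigma>k: "\<sigma> j \<in> {1..k}" if "j \<in> {1..k}" for j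
    using 1(1) that by (simp only: permutes_in_image)
  let ?s = "\<lambda>j\<in>{1..k}. if j = 1 then c *\<^sub>R u j else u j"
  let ?t = "\<lambda>j\<in>{1..k}. if j = 1 then c *\<^sub>R u' j else u' j"
  \<comment> \<open>The scalar \<open>a j\<close> is what the absorption puts in front of the factor \<open>j\<close>.\<close>
  let ?\<nu> = "\<lambda>j. \<mu> j * a j / a (\<sigma> j)"
  have "(\<Prod>j\<in>{1..k}. a (\<sigma> j)) = (\<Prod>j\<in>{1..k}. a j)"
    using prod.permute[OF 1(1), of a] by (simp add: comp_def)
  moreover have "(\<Prod>j\<in>{1..k}. a j) \<noteq> 0" using a by simp
  ultimately have "(\<Prod>j\<in>{1..k}. ?\<nu> j) = 1"
    using 1(2) by (simp add: prod_dividef prod.distrib)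
  moreover have "?t j = ?\<nu> j *\<^sub>R ?s (\<sigma> j)" if "j \<in> {1..k}" for j
  proof -
    have "?t j = a j *\<^sub>R u' j" "?s (\<sigma> j) = a (\<sigma> j) *\<^sub>R u (\<sigma> j)"
      using that \<sigma>k[OF that] by (auto simp: a_def)
    moreover have "u' j = \<mu> j *\<^sub>R u (\<sigma> j)"
      using 1(3) that \<sigma>k[OF that] by auto
    ultimately show ?thesis using a[of "\<sigma> j"] by simp
  qed
  ultimately have "(?s, ?t) \<in> multipole_rel k"
    by (intro multipole_relI[of ?s k ?t \<sigma> ?\<nu>] 1(1)
        absorbed_factor_tuple[OF False nz(1)] absorbed_factor_tuple[OF False nz(2)])
  then show ?thesis
    using equiv_class_eq[OF multipole_rel_equiv] False by (simp add: associated_multipole_def)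
qed (simp add: associated_multipole_def)

theorem theorem13:
  fixes Q P :: "real poly3" and d :: nat
  assumes "quadratic_form Q"
    and "irreducible (complexify Q)"
    and "signature Q \<noteq> - 3"
    and "total_degree P = d"
  shows "(\<exists>c u. multipole_representation Q P d c u) \<and>
    (ellipsoid (quadric_surface Q) \<longrightarrow>
      (\<forall>c u c' u'.
         multipole_representation Q P d c u \<longrightarrow> multipole_representation Q P d c' u' \<longrightarrow>
         (\<forall>k\<le>d. c k = c' k) \<and>
         (\<forall>k\<in>{1..d}. c k \<noteq> 0 \<longrightarrow>
            (restrict (u k) {1..k}, restrict (u' k) {1..k}) \<in> multipole_rel k)) \<and>
      (\<exists>!w. w \<in> (\<Pi>\<^sub>E k\<in>{1..d}. extended_multipole_space k) \<and>
         (\<exists>c u. multipole_representation Q P d c u \<and>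
            (\<forall>k\<in>{1..d}. w k = associated_multipole k (c k) (u k)))))"
proof -
  obtain N where N: "self_adjoint_map N" "\<And>v. eval3 Q v = v \<bullet> N v" "\<And>v. N v = 0 \<Longrightarrow> v = 0"
    using irreducible_quadratic_form_nondegenerate[OF assms(1,2)] by blast
  have "splits_on (quadric_surface Q)"
    using self_adjoint_map.splits_on_nondegenerate_quadric[OF N(1,3)]
    by (simp add: quadric_surface_def N(2))
  then have ex: "\<exists>c u. multipole_representation Q P d c u"
    using multipole_representation_exists assms(4) by blast
  have unique: "(\<forall>k\<le>d. c k = c' k) \<and> (\<forall>k\<in>{1..d}. c k \<noteq> 0 \<longrightarrow>
            (restrict (u k) {1..k}, restrict (u' k) {1..k}) \<in> multipole_rel k)"
    if "ellipsoid (quadric_surface Q)" "multipole_representation Q P d c u"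
      "multipole_representation Q P d c' u'" for c u c' u'
    by (rule ellipsoid_uniqueness[OF that(1)])
       (use that(2,3) in \<open>auto simp: multipole_representation_def unit_coefficients_def\<close>)
  have "\<exists>!w. w \<in> (\<Pi>\<^sub>E k\<in>{1..d}. extended_multipole_space k) \<and>
         (\<exists>c u. multipole_representation Q P d c u \<and>
            (\<forall>k\<in>{1..d}. w k = associated_multipole k (c k) (u k)))"
    if E: "ellipsoid (quadric_surface Q)"
  proof -
    obtain c u where cu: "multipole_representation Q P d c u" using ex by blast
    then have nz: "u k j \<noteq> 0" if "k \<in> {1..d}" "j \<in> {1..k}" for k j
      using that unfolding multipole_representation_def by (metis norm_zero zero_neq_one)
    let ?w = "\<lambda>k\<in>{1..d}. associated_multipole k (c k) (u k)"
    show ?thesis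
    proof (rule ex1I[of _ ?w])
      show "?w \<in> (\<Pi>\<^sub>E k\<in>{1..d}. extended_multipole_space k) \<and>
         (\<exists>c u. multipole_representation Q P d c u \<and>
            (\<forall>k\<in>{1..d}. ?w k = associated_multipole k (c k) (u k)))"
        using cu nz associated_multipole_in_space by (intro conjI exI[of _ c] exI[of _ u]) auto
    next
      fix w assume w: "w \<in> (\<Pi>\<^sub>E k\<in>{1..d}. extended_multipole_space k) \<and>
         (\<exists>c u. multipole_representation Q P d c u \<and>
            (\<forall>k\<in>{1..d}. w k = associated_multipole k (c k) (u k)))"
      then obtain c' u' where cu': "multipole_representation Q P d c' u'"
        "\<And>k. k \<in> {1..d} \<Longrightarrow> w k = associated_multipole k (c' k) (u' k)" by blast
      note un = unique[OF E cu cu'(1)]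
      show "w = ?w"
      proof
        fix k
        show "w k = ?w k"
        proof (cases "k \<in> {1..d}")
          case True
          then have "c' k = c k" using un by simp
          moreover have "associated_multipole k (c k) (u k) = associated_multipole k (c k) (u' k)"
            by (rule associated_multipole_eq) (use True un in auto)
          ultimately show ?thesis using cu'(2)[OF True] True by simp
        next
          case False
          then have "w k = undefined" using w by (meson PiE_arb)
          then show ?thesis using False by auto
        qed
      qed
    qed
  qed
  then show ?thesis using ex unique by blast
qed

end
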